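(* For all $\tau$ in the upper half-plane $\mathbb{H}$, with $u,v,w$ as in the context, $$\frac{u^2}{v}-\frac{v^2}{w}+\frac{w^2}{u}=0$$ and $$\frac{v}{u^2}-\frac{w}{v^2}+\frac{u}{w^2}=\frac{\eta(\tau)}{\eta^2(7\tau)}\,j_7^*(\tau)^{1/3},$$ where $j_7^*(\tau)^{1/3}$ denotes the cube root of $j_7^*(\tau)$ which is meromorphic on $\mathbb{H}$ and whose $q$-expansion begins $q^{-1/3}(1+O(q))$.
   Context: Let $\tau\in\mathbb{H}$, $q=e^{2\pi i\tau}$, and for real $\alpha$ write $q^{\alpha}=e^{2\pi i\alpha\tau}$. Define $u=q^{1/56}\prod_{k\ge0}(1-q^{7k+3})(1-q^{7k+4})(1-q^{7k+7})$, $v=q^{9/56}\prod_{k\ge0}(1-q^{7k+2})(1-q^{7k+5})(1-q^{7k+7})$, $w=q^{25/56}\prod_{k\ge0}(1-q^{7k+1})(1-q^{7k+6})(1-q^{7k+7})$ (equivalently $u=q^{1/56}f(-q^3,-q^4)$, $v=q^{9/56}f(-q^2,-q^5)$, $w=q^{25/56}f(-q,-q^6)$ with Ramanujan's $f(a,b)=\sum_{n\in\mathbb{Z}}a^{n(n+1)/2}b^{n(n-1)/2}$). Let $\eta(\tau)=q^{1/24}\prod_{n\ge1}(1-q^n)$ be the Dedekind eta function and $j_7^*(\tau)=\left(\frac{\eta(\tau)}{\eta(7\tau)}\right)^4+13+49\left(\frac{\eta(7\tau)}{\eta(\tau)}\right)^4$. *)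

theory Defs
  imports "HOL-Complex_Analysis.Complex_Analysis"
begin

definition upper_half_plane :: "complex set" where
  "upper_half_plane = {\<tau>. Im \<tau> > 0}"

definition qn :: "complex \<Rightarrow> complex" where
  "qn \<tau> = exp (2 * of_real pi * \<i> * \<tau>)"

definition qpow :: "real \<Rightarrow> complex \<Rightarrow> complex" where
  "qpow \<alpha> \<tau> = exp (2 * of_real pi * \<i> * of_real \<alpha> * \<tau>)"

definition u_fun :: "complex \<Rightarrow> complex" where
  "u_fun \<tau> = qpow (1/56) \<tau> *
     (\<Prod>k. (1 - qn \<tau> ^ (7*k+3)) * (1 - qn \<tau> ^ (7*k+4)) * (1 - qn \<tau> ^ (7*k+7)))"

definition v_fun :: "complex \<Rightarrow> complex" where
  "v_fun \<tau> = qpow (9/56) \<tau> *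
     (\<Prod>k. (1 - qn \<tau> ^ (7*k+2)) * (1 - qn \<tau> ^ (7*k+5)) * (1 - qn \<tau> ^ (7*k+7)))"

definition w_fun :: "complex \<Rightarrow> complex" where
  "w_fun \<tau> = qpow (25/56) \<tau> *
     (\<Prod>k. (1 - qn \<tau> ^ (7*k+1)) * (1 - qn \<tau> ^ (7*k+6)) * (1 - qn \<tau> ^ (7*k+7)))"

definition eta :: "complex \<Rightarrow> complex" where
  "eta \<tau> = qpow (1/24) \<tau> * (\<Prod>n. (1 - qn \<tau> ^ (n+1)))"

definition j7star :: "complex \<Rightarrow> complex" where
  "j7star \<tau> = (eta \<tau> / eta (7*\<tau>)) ^ 4 + 13 + 49 * (eta (7*\<tau>) / eta \<tau>) ^ 4"

end

theory Submission
  imports Defs "HOL-Library.Nat_Bijection"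
begin

text \<open>
  All functions are theta products in $q$. Write $T_k = f(-q^k, -q^{7-k})$, $F = \prod (1 - q^n)$ and
  $G = \prod (1 - q^{7n})$. By the Jacobi triple product, products of two theta values are
  $2 \times 2$ minors of a matrix with two rows; the Pluecker relation between them is the Klein quartic
  $T_3^3 T_1 - T_2^3 T_3 + q T_1^3 T_2 = 0$, which is the first identity. The quintuple product identity
  gives, for $q = t^7$, the dissection
  $F(t) = G(q) (T_2/T_1 - t\, T_3/T_2 - t^2 + t^5\, T_1/T_3)$.
  Multiply it over the seven values of $t$. With $h = T_3^2 T_1 / T_2^3$ the Klein quartic says that
  $x = T_3/(t T_2)$ satisfies $x^7 (1 - h) = h^3$, and the norm of the right-hand side becomes the square
  of $X = (h^3 - 8h^2 + 5h + 1)/(h^2 - h)$; hence $\eta(\tau)^4/\eta(7\tau)^4 = \pm X$, and $q \to 0$ gives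
  the sign. The second identity is then
  $X^2 + 13 X + 49 = (h^2 - h + 1)^3/(h^2 - h)^2$ together with $T_1 T_2 T_3 = F G^2$.
\<close>

subsection \<open>Infinite $q$-Pochhammer products\<close>

text \<open>No modular transformation formula enters: every step is an identity of products in q on
  the unit disc. The norm is computable because the four terms of the dissection, divided by t^2,
  become y^2/h, -y, -1 and h/y^3 in the single quantity y = T_3/(t T_2), so their sum is a quintic
  in y over h y^3. Passing to a conjugate of t multiplies y by a seventh root of unity. Hence the
  norm of the quintic is a polynomial in y^7, and the Klein quartic makes y^7 rational in h. On the
  other side the product of F over the seven roots is F(q)^8/G(q), so the norm of the bracket is
  (F/G)^8. It has to come out as a square, and the cubic h^3 - 8h^2 + 5h + 1 is the root that
  appears. No cube root is ever extracted. The left side of the second identity times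
  eta(7\<tau>)^2/eta(\<tau>) is declared to be the root, so the second identity holds by
  construction and the content is that its cube is j_7^*. Up to the factor q^(-1/3) this root is a
  holomorphic function of q on the disc with value 1 at 0, which gives both its regularity and its
  normalisation.\<close>

definition qpoch :: "complex \<Rightarrow> complex \<Rightarrow> complex" where
  "qpoch z Q = (\<Prod>k. 1 - z * Q ^ k)"

lemma qpoch_has_prod:
  assumes "norm Q < 1"
  shows "(\<lambda>k. 1 - z * Q ^ k) has_prod qpoch z Q"
proof -
  have "summable (\<lambda>k. norm z * norm Q ^ k)"
    using assms by (intro summable_mult summable_geometric) auto
  then have "abs_convergent_prod (\<lambda>k. 1 - z * Q ^ k)"
    by (simp add: abs_convergent_prod_conv_summable norm_mult norm_power)
  then show ?thesis
    unfolding qpoch_def by (intro convergent_prod_has_prod abs_convergent_prod_imp_convergent_prod)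
qed

lemma qpoch_LIMSEQ:
  assumes "norm Q < 1"
  shows "(\<lambda>n. \<Prod>k<n. 1 - z * Q ^ k) \<longlonglongrightarrow> qpoch z Q"
  by (rule has_prod_imp_tendsto'[OF qpoch_has_prod[OF assms]])

lemma qpoch_nonzero:
  assumes "norm Q < 1" "norm z < 1"
  shows "qpoch z Q \<noteq> 0"
proof -
  have "z * Q ^ k \<noteq> 1" for k
  proof
    assume "z * Q ^ k = 1"
    then have "norm z * norm Q ^ k = 1"
      by (metis norm_mult norm_one norm_power)
    moreover have "norm z * norm Q ^ k \<le> norm z * 1"
      using assms by (intro mult_left_mono power_le_one) auto
    ultimately show False using assms by simp
  qed
  then show ?thesis
    using has_prod_eq_0_iff[OF qpoch_has_prod[OF assms(1), of z]] by auto
qed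

text \<open>Sort the exponents by residue modulo m. Partial products of length n * m rearrange
  exactly, and the limit along this subsequence gives the claim.\<close>

lemma qpoch_split:
  assumes "norm Q < 1" "m > 0"
  shows "qpoch z Q = (\<Prod>r<m. qpoch (z * Q ^ r) (Q ^ m))"
proof (rule LIMSEQ_unique)
  have "filterlim (\<lambda>n. n * m) sequentially sequentially"
    using assms(2) by (intro filterlim_subseq) (auto simp: strict_mono_def)
  from filterlim_compose[OF qpoch_LIMSEQ[OF assms(1), of z] this]
  show "(\<lambda>n. \<Prod>k<n * m. 1 - z * Q ^ k) \<longlonglongrightarrow> qpoch z Q" .
  have "(\<Prod>k<n * m. 1 - z * Q ^ k) = (\<Prod>r<m. \<Prod>k<n. 1 - z * Q ^ r * (Q ^ m) ^ k)" for n
  proof -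
    have "(\<Prod>k<n * m. 1 - z * Q ^ k) = (\<Prod>k<n. \<Prod>j\<in>{k*m..<k*m+m}. 1 - z * Q ^ j)"
      by (rule prod.nat_group[symmetric])
    also have "\<dots> = (\<Prod>k<n. \<Prod>r<m. 1 - z * Q ^ r * (Q ^ m) ^ k)"
    proof (rule prod.cong[OF refl])
      fix k
      show "(\<Prod>j\<in>{k*m..<k*m+m}. 1 - z * Q ^ j) = (\<Prod>r<m. 1 - z * Q ^ r * (Q ^ m) ^ k)"
        by (rule prod.reindex_bij_witness[of _ "\<lambda>r. k * m + r" "\<lambda>j. j - k * m"])
           (auto simp flip: power_mult power_add simp: algebra_simps)
    qed
    finally show ?thesis by (subst prod.swap)
  qed
  moreover have "norm (Q ^ m) < 1"
    using assms by (simp add: norm_power power_less_one_iff)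
  ultimately show "(\<lambda>n. \<Prod>k<n * m. 1 - z * Q ^ k) \<longlonglongrightarrow> (\<Prod>r<m. qpoch (z * Q ^ r) (Q ^ m))"
    by (simp add: tendsto_prod qpoch_LIMSEQ)
qed

text \<open>Locally uniform convergence by the M-test. Holomorphy in q is needed twice: for the sign
  in \<open>euler_quotient_power4\<close> and for the regularity of the cube root.\<close>

lemma holomorphic_qpoch:
  assumes "open S" "f holomorphic_on S" "g holomorphic_on S" "\<And>x. x \<in> S \<Longrightarrow> norm (g x) < 1"
  shows "(\<lambda>x. qpoch (f x) (g x)) holomorphic_on S"
proof (rule holomorphic_uniform_sequence[OF assms(1)])
  show "(\<lambda>x. \<Prod>k<n. 1 - f x * g x ^ k) holomorphic_on S" for n
    by (intro holomorphic_intros assms)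
  fix x assume "x \<in> S"
  then obtain d where d: "d > 0" "cball x d \<subseteq> S"
    using assms(1) open_contains_cball by blast
  have cont: "continuous_on (cball x d) f" "continuous_on (cball x d) g"
    using assms(2,3) d holomorphic_on_imp_continuous_on continuous_on_subset by blast+
  have "compact (f ` cball x d)"
    using cont by (intro compact_continuous_image) auto
  then obtain C where C: "\<And>y. y \<in> cball x d \<Longrightarrow> norm (f y) \<le> C"
    by (metis bounded_iff compact_imp_bounded image_eqI)
  have "continuous_on (cball x d) (\<lambda>y. norm (g y))"
    using cont by (intro continuous_intros)
  \<comment> \<open>The maximum of \<open>norm (g y)\<close> is attained on the closed ball, so it
    is strictly below 1 and gives the geometric majorant \<open>C * r ^ k\<close>.\<close>
  then obtain y0 where y0: "y0 \<in> cball x d" "\<And>y. y \<in> cball x d \<Longrightarrow> norm (g y) \<le> norm (g y0)"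
    using continuous_attains_sup[of "cball x d" "\<lambda>y. norm (g y)"] d by auto
  define r where "r = norm (g y0)"
  have r: "r < 1" "r \<ge> 0" "\<And>y. y \<in> cball x d \<Longrightarrow> norm (g y) \<le> r"
    using y0 d assms(4) by (auto simp: r_def)
  have C0: "C \<ge> 0" using C[of x] d by (metis centre_in_cball less_eq_real_def norm_ge_zero order_trans)
  have "uniformly_convergent_on (cball x d) (\<lambda>N y. \<Prod>k<N. 1 - f y * g y ^ k)"
  proof (rule uniformly_convergent_on_prod')
    show "continuous_on (cball x d) (\<lambda>y. 1 - f y * g y ^ n)" for n
      by (intro continuous_intros cont)
    show "uniformly_convergent_on (cball x d) (\<lambda>N y. \<Sum>k<N. norm (1 - f y * g y ^ k - 1))"
    proof (rule Weierstrass_m_test')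
      show "norm (norm (1 - f y * g y ^ k - 1)) \<le> C * r ^ k" if "y \<in> cball x d" for k y
        using C[OF that] r(2) r(3)[OF that] C0
        by (auto simp: norm_mult norm_power intro!: mult_mono power_mono)
      show "summable (\<lambda>k. C * r ^ k)"
        using r by (intro summable_mult summable_geometric) auto
    qed
  qed auto
  then have ul: "uniform_limit (cball x d) (\<lambda>N y. \<Prod>k<N. 1 - f y * g y ^ k)
      (\<lambda>y. lim (\<lambda>N. \<Prod>k<N. 1 - f y * g y ^ k)) sequentially"
    by (simp add: uniformly_convergent_uniform_limit_iff)
  have "uniform_limit (cball x d) (\<lambda>N y. \<Prod>k<N. 1 - f y * g y ^ k)
      (\<lambda>y. qpoch (f y) (g y)) sequentially"
  proof (rule uniform_limit_cong'[THEN iffD1, OF _ _ ul])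
    fix y assume "y \<in> cball x d"
    then have "norm (g y) < 1" using d assms(4) by blast
    then show "lim (\<lambda>N. \<Prod>k<N. 1 - f y * g y ^ k) = qpoch (f y) (g y)"
      by (intro limI qpoch_LIMSEQ)
  qed auto
  then show "\<exists>d>0. cball x d \<subseteq> S \<and> uniform_limit (cball x d) (\<lambda>N y. \<Prod>k<N. 1 - f y * g y ^ k)
      (\<lambda>y. qpoch (f y) (g y)) sequentially"
    using d by blast
qed

subsection \<open>The Jacobi triple product\<close>

definition qfact :: "complex \<Rightarrow> nat \<Rightarrow> complex" where
  "qfact Q n = (\<Prod>k<n. 1 - Q ^ Suc k)"

text \<open>The Gaussian binomial as a quotient of complex numbers, legitimate for norm of Q below
  1. The value 0 for k > n lets the Pascal rule hold at the right edge.\<close>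

definition qbinomial :: "complex \<Rightarrow> nat \<Rightarrow> nat \<Rightarrow> complex" where
  "qbinomial Q n k = (if k \<le> n then qfact Q n / (qfact Q k * qfact Q (n - k)) else 0)"

lemma qfact_nonzero: "norm Q < 1 \<Longrightarrow> qfact Q n \<noteq> 0"
proof -
  assume Q: "norm Q < 1"
  have "Q ^ Suc k \<noteq> 1" for k
  proof
    assume "Q ^ Suc k = 1"
    then have "norm Q ^ Suc k = 1" by (metis norm_one norm_power)
    then show False using Q power_less_one_iff[of "norm Q" "Suc k"] by auto
  qed
  then show ?thesis by (simp add: qfact_def)
qed

lemma qfact_Suc: "qfact Q (Suc n) = qfact Q n * (1 - Q ^ Suc n)"
  by (simp add: qfact_def)

lemma qfact_0 [simp]: "qfact Q 0 = 1"
  by (simp add: qfact_def)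

text \<open>For k < n, clearing denominators leaves 1 - Q^(n+1) = (1 - Q^(n-k)) + Q^(n-k) (1 -
  Q^(k+1)).\<close>

lemma qbinomial_Suc_Suc:
  assumes "norm Q < 1" "k \<le> n"
  shows "qbinomial Q (Suc n) (Suc k) = qbinomial Q n (Suc k) + Q ^ (n - k) * qbinomial Q n k"
proof (cases "k = n")
  case True
  then show ?thesis using qfact_nonzero[OF assms(1)] by (simp add: qbinomial_def)
next
  case False
  then obtain m where m: "n = Suc k + m"
    using assms(2) by (metis le_less less_natE add_Suc)
  have nz: "qfact Q i \<noteq> 0" for i by (rule qfact_nonzero[OF assms(1)])
  have 1: "1 - Q ^ Suc i \<noteq> 0" for i
    using nz[of "Suc i"] by (auto simp: qfact_Suc)
  have *: "qfact Q k * (1 - Q ^ Suc k) \<noteq> 0" "qfact Q m * (1 - Q ^ Suc m) \<noteq> 0"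
    using nz 1 by auto
  have "1 - Q ^ (Suc (Suc (k + m))) = (1 - Q ^ Suc m) + Q ^ Suc m * (1 - Q ^ Suc k)"
    by (simp add: algebra_simps power_add)
  moreover have "qbinomial Q (Suc n) (Suc k) = qfact Q n * (1 - Q ^ Suc (Suc (k + m))) /
      ((qfact Q k * (1 - Q ^ Suc k)) * (qfact Q m * (1 - Q ^ Suc m)))"
    using m by (simp add: qbinomial_def qfact_Suc del: power_Suc)
  moreover have "qbinomial Q n (Suc k) = qfact Q n / ((qfact Q k * (1 - Q ^ Suc k)) * qfact Q m)"
    using m by (simp add: qbinomial_def qfact_Suc del: power_Suc)
  moreover have "qbinomial Q n k = qfact Q n / (qfact Q k * (qfact Q m * (1 - Q ^ Suc m)))"
    using m by (simp add: qbinomial_def qfact_Suc del: power_Suc)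
  moreover have "n - k = Suc m" using m by simp
  moreover have "Y * (b + x * a) / ((K * a) * (M * b)) = Y / ((K * a) * M) + x * (Y / (K * (M * b)))"
    if "a \<noteq> 0" "b \<noteq> 0" "K \<noteq> 0" "M \<noteq> 0" for Y a b x K M :: complex
    using that by (simp add: divide_simps) (simp add: algebra_simps)
  ultimately show ?thesis using nz 1 by (metis (no_types, lifting))
qed

lemma qbinomial_theorem:
  assumes "norm Q < 1"
  shows "(\<Prod>k<n. 1 + x * Q ^ k) = (\<Sum>i\<le>n. qbinomial Q n i * Q ^ (i * (i - 1) div 2) * x ^ i)"
proof (induction n)
  case (Suc n)
  define c where "c i = Q ^ (i * (i - 1) div 2) * x ^ i" for i
  have c_Suc: "Q ^ (n - i) * c (Suc i) = x * Q ^ n * c i" if "i \<le> n" for i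
  proof -
    have "Suc i * i = i * (i - 1) + 2 * i" by (cases i) auto
    then have "Suc i * i div 2 = i * (i - 1) div 2 + i" by simp
    moreover have "Q ^ n = Q ^ (n - i) * Q ^ i" using that by (simp flip: power_add)
    ultimately show ?thesis by (simp add: c_def power_add)
  qed
  have z: "qbinomial Q n (Suc n) = 0" by (simp add: qbinomial_def)
  have b0: "qbinomial Q m 0 = 1" for m using qfact_nonzero[OF assms] by (simp add: qbinomial_def)
  have "(\<Sum>i\<le>Suc n. qbinomial Q (Suc n) i * c i)
      = c 0 + (\<Sum>i\<le>n. qbinomial Q (Suc n) (Suc i) * c (Suc i))"
    by (subst sum.atMost_Suc_shift) (simp add: b0)
  also have "(\<Sum>i\<le>n. qbinomial Q (Suc n) (Suc i) * c (Suc i))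
      = (\<Sum>i\<le>n. qbinomial Q n (Suc i) * c (Suc i)) + (\<Sum>i\<le>n. qbinomial Q n i * (Q ^ (n - i) * c (Suc i)))"
    unfolding sum.distrib[symmetric]
    by (intro sum.cong refl) (simp add: qbinomial_Suc_Suc[OF assms] algebra_simps)
  also have "(\<Sum>i\<le>n. qbinomial Q n i * (Q ^ (n - i) * c (Suc i))) = x * Q ^ n * (\<Sum>i\<le>n. qbinomial Q n i * c i)"
    unfolding sum_distrib_left by (intro sum.cong refl) (simp add: c_Suc)
  also have "c 0 + ((\<Sum>i\<le>n. qbinomial Q n (Suc i) * c (Suc i)) + x * Q ^ n * (\<Sum>i\<le>n. qbinomial Q n i * c i))
      = (\<Sum>i\<le>Suc n. qbinomial Q n i * c i) + x * Q ^ n * (\<Sum>i\<le>n. qbinomial Q n i * c i)"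
    by (subst sum.atMost_Suc_shift) (simp add: b0)
  also have "(\<Sum>i\<le>Suc n. qbinomial Q n i * c i) = (\<Sum>i\<le>n. qbinomial Q n i * c i)"
    by (simp add: z)
  finally have "(\<Sum>i\<le>Suc n. qbinomial Q (Suc n) i * c i) = (\<Sum>i\<le>n. qbinomial Q n i * c i) * (1 + x * Q ^ n)"
    by (simp add: algebra_simps)
  then show ?case using Suc by (simp add: c_def mult.assoc)
qed (simp add: qbinomial_def)

text \<open>Ramanujan's f(-z, -Q/z); the T_k of the overview is
  \<open>jac (q ^ k) (q ^ 7)\<close>.\<close>

definition jac :: "complex \<Rightarrow> complex \<Rightarrow> complex" where
  "jac z Q = qpoch z Q * qpoch (Q / z) Q * qpoch Q Q"

text \<open>The term (-1)^n Q^(n(n-1)/2) z^n with Q = exp A and z = exp B. Carrying logarithms turns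
  every later change of summation variables into polynomial arithmetic in the exponent.\<close>

definition jterm :: "complex \<Rightarrow> complex \<Rightarrow> int \<Rightarrow> complex" where
  "jterm A B n = (-1) powi n * exp (A * of_int n * (of_int n - 1) / 2 + B * of_int n)"

text \<open>The q-binomial theorem with 2N factors, centred: half of the factors are 1 - z Q^k, and
  the other half, read backwards, are 1 - Q^(k+1)/z up to a monomial. That monomial also occurs in
  each term of the sum and cancels.\<close>

lemma finite_triple_product:
  assumes "Re A < 0"
  shows "(\<Prod>k<N. 1 - exp B * exp A ^ k) * (\<Prod>k<N. 1 - exp A / exp B * exp A ^ k)
       = (\<Sum>j\<in>{-int N..int N}. qbinomial (exp A) (2 * N) (nat (j + int N)) * jterm A B j)"
proof -
  have nA: "norm (exp A) < 1" using assms by simp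
  \<comment> \<open>This is -z Q^(-N): the shift by N makes the summation index run symmetrically
    from -N to N.\<close>
  define x where "x = - exp (B - A * of_nat N)"
  have "(\<Prod>k<2 * N. 1 + x * exp A ^ k) = (\<Prod>k<N. 1 + x * exp A ^ k) * (\<Prod>k<N. 1 + x * exp A ^ (N + k))"
  proof -
    have "{..<2 * N} = {..<N} \<union> {N..<N + N}" by auto
    moreover have "(\<Prod>k\<in>{N..<N + N}. 1 + x * exp A ^ k) = (\<Prod>k<N. 1 + x * exp A ^ (N + k))"
      by (rule prod.reindex_bij_witness[of _ "\<lambda>k. N + k" "\<lambda>k. k - N"]) auto
    ultimately show ?thesis by (simp add: prod.union_disjoint ivl_disj_int)
  qed
  also have "(\<Prod>k<N. 1 + x * exp A ^ (N + k)) = (\<Prod>k<N. 1 - exp B * exp A ^ k)"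
    by (intro prod.cong refl)
       (simp add: x_def algebra_simps flip: exp_of_nat_mult exp_add)
  also have "(\<Prod>k<N. 1 + x * exp A ^ k) = (\<Prod>k<N. 1 + x * exp A ^ (N - Suc k))"
    by (rule prod.nat_diff_reindex[symmetric])
  also have "\<dots> = (\<Prod>k<N. - exp (B - A * of_nat (Suc k)) * (1 - exp A / exp B * exp A ^ k))"
  proof (intro prod.cong refl)
    fix k assume "k \<in> {..<N}"
    then obtain m where m: "N = Suc k + m"
      by (metis lessThan_iff less_iff_Suc_add add_Suc)
    have "x * exp A ^ (N - Suc k) = - exp (B - A * of_nat (Suc k))"
      by (simp add: x_def m algebra_simps flip: exp_of_nat_mult exp_add)
    moreover have "exp (B - A * of_nat (Suc k)) * (exp A / exp B * exp A ^ k) = 1"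
      by (simp add: algebra_simps flip: exp_of_nat_mult exp_add exp_diff)
    ultimately show "1 + x * exp A ^ (N - Suc k) = - exp (B - A * of_nat (Suc k)) * (1 - exp A / exp B * exp A ^ k)"
      by (simp add: algebra_simps)
  qed
  also have "\<dots> = (\<Prod>k<N. - exp (B - A * of_nat (Suc k))) * (\<Prod>k<N. 1 - exp A / exp B * exp A ^ k)"
    by (rule prod.distrib)
  also have "(\<Prod>k<N. - exp (B - A * of_nat (Suc k))) = (-1) ^ N * exp (B * of_nat N - A * of_nat N * (of_nat N + 1) / 2)"
    by (induction N) (auto simp: algebra_simps add_divide_distrib simp flip: exp_add)
  finally have L: "(\<Prod>k<2 * N. 1 + x * exp A ^ k) =
     (-1) ^ N * exp (B * of_nat N - A * of_nat N * (of_nat N + 1) / 2) *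
      ((\<Prod>k<N. 1 - exp B * exp A ^ k) * (\<Prod>k<N. 1 - exp A / exp B * exp A ^ k))"
    by (simp add: mult_ac)
  have "(\<Prod>k<2 * N. 1 + x * exp A ^ k) =
      (\<Sum>i\<le>2*N. qbinomial (exp A) (2 * N) i * exp A ^ (i * (i - 1) div 2) * x ^ i)"
    by (rule qbinomial_theorem[OF nA])
  also have "\<dots> = (\<Sum>i\<le>2*N. (-1) ^ N * exp (B * of_nat N - A * of_nat N * (of_nat N + 1) / 2) *
     (qbinomial (exp A) (2 * N) i * jterm A B (int i - int N)))"
  proof (intro sum.cong refl)
    fix i :: nat
    have "2 * (i * (i - 1) div 2) = i * (i - 1)"
      by (intro dvd_mult_div_cancel) (cases i, auto)
    then have "2 * (of_nat (i * (i - 1) div 2) :: complex) = of_nat (i * (i - 1))"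
      by (metis of_nat_mult of_nat_numeral)
    moreover have "(of_nat (i * (i - 1)) :: complex) = of_nat i * (of_nat i - 1)"
      by (cases i) (auto simp: algebra_simps)
    ultimately have i2: "(of_nat (i * (i - 1) div 2) :: complex) = of_nat i * (of_nat i - 1) / 2"
      by (simp add: field_simps)
    have "exp A ^ (i * (i - 1) div 2) = exp (A * (of_nat i * (of_nat i - 1) / 2))"
      by (simp only: i2 mult.commute[of A] flip: exp_of_nat_mult)
    moreover have "x ^ i = (-1) ^ i * exp ((B - A * of_nat N) * of_nat i)"
      unfolding x_def power_minus[of "exp _"] by (simp add: exp_of_nat2_mult)
    ultimately have "exp A ^ (i * (i - 1) div 2) * x ^ i
        = (-1) ^ i * exp (A * (of_nat i * (of_nat i - 1) / 2) + (B - A * of_nat N) * of_nat i)"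
      by (simp add: exp_add)
    moreover have "(-1::complex) powi (int i - int N) * (-1) ^ N = (-1) ^ i"
      by (simp add: power_int_diff)
    moreover have "(A * (of_nat i * (of_nat i - 1) / 2) + (B - A * of_nat N) * of_nat i)
       = (B * of_nat N - A * of_nat N * (of_nat N + 1) / 2) + 
         (A * of_int (int i - int N) * (of_int (int i - int N) - 1) / 2 + B * of_int (int i - int N))"
      by (simp add: field_simps)
    ultimately have "exp A ^ (i * (i - 1) div 2) * x ^ i = ((-1) powi (int i - int N) * (-1) ^ N) *
        exp ((B * of_nat N - A * of_nat N * (of_nat N + 1) / 2) +
         (A * of_int (int i - int N) * (of_int (int i - int N) - 1) / 2 + B * of_int (int i - int N)))"
      by (simp only:)
    also have "\<dots> = (-1) ^ N * exp (B * of_nat N - A * of_nat N * (of_nat N + 1) / 2) * jterm A B (int i - int N)"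
      unfolding jterm_def exp_add by (simp only: mult_ac)
    finally show "qbinomial (exp A) (2 * N) i * exp A ^ (i * (i - 1) div 2) * x ^ i =
      (-1) ^ N * exp (B * of_nat N - A * of_nat N * (of_nat N + 1) / 2) *
     (qbinomial (exp A) (2 * N) i * jterm A B (int i - int N))"
      by (metis mult.assoc mult.left_commute)
  qed
  also have "\<dots> = (-1) ^ N * exp (B * of_nat N - A * of_nat N * (of_nat N + 1) / 2) *
     (\<Sum>i\<le>2*N. qbinomial (exp A) (2 * N) i * jterm A B (int i - int N))"
    by (simp add: sum_distrib_left)
  also have "(\<Sum>i\<le>2*N. qbinomial (exp A) (2 * N) i * jterm A B (int i - int N))
    = (\<Sum>j\<in>{-int N..int N}. qbinomial (exp A) (2 * N) (nat (j + int N)) * jterm A B j)"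
    by (rule sum.reindex_bij_witness[of _ "\<lambda>j. nat (j + int N)" "\<lambda>i. int i - int N"]) auto
  finally show ?thesis using L by simp
qed

lemma summable_on_power_nat_abs:
  fixes x :: real
  assumes "0 \<le> x" "x < 1"
  shows "(\<lambda>n::int. x ^ nat \<bar>n\<bar>) summable_on UNIV"
proof -
  have s: "(\<lambda>n. x ^ n) summable_on UNIV"
    using assms by (intro summable_nonneg_imp_summable_on summable_geometric) auto
  have "(\<lambda>n::int. x ^ nat \<bar>n\<bar>) summable_on range int"
    by (subst summable_on_reindex) (use s in \<open>auto simp: o_def\<close>)
  moreover have "(\<lambda>n::int. x ^ nat \<bar>n\<bar>) summable_on range (\<lambda>n. - int n)"
    by (subst summable_on_reindex) (use s in \<open>auto simp: o_def inj_def\<close>)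
  ultimately have "(\<lambda>n::int. x ^ nat \<bar>n\<bar>) summable_on range int \<union> range (\<lambda>n. - int n)"
    by (rule summable_on_union)
  also have "range int \<union> range (\<lambda>n. - int n) = UNIV"
    by (auto simp: image_iff) (metis int_cases2)
  finally show ?thesis .
qed

lemma norm_jterm: "norm (jterm A B n) = exp (Re A * of_int n * (of_int n - 1) / 2 + Re B * of_int n)"
proof -
  have "A * of_int n * (of_int n - 1) / 2 + B * of_int n = A * of_real (of_int n * (of_int n - 1) / 2) + B * of_real (of_int n)"
    by simp
  then have "Re (A * of_int n * (of_int n - 1) / 2 + B * of_int n) = Re A * of_int n * (of_int n - 1) / 2 + Re B * of_int n"
    by (simp only: plus_complex.simps Re_complex_of_real times_complex.simps Im_complex_of_real)
  then show ?thesis by (simp add: jterm_def norm_mult norm_power_int)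
qed

text \<open>The exponent is quadratic in n with negative leading coefficient; completing the square
  leaves a two-sided geometric majorant.\<close>

lemma abs_summable_jterm:
  assumes "Re A < 0"
  shows "(\<lambda>n. norm (jterm A B n)) summable_on UNIV"
proof -
  define r where "r = - Re A"
  \<comment> \<open>The extra 1 absorbs an additional |n| into the square, and this |n| becomes the
    decay \<open>exp (-1) ^ nat \<bar>n\<bar>\<close>.\<close>
  define K where "K = \<bar>r / 2 + Re B\<bar> + 1"
  have r: "r > 0" using assms by (simp add: r_def)
  have "norm (jterm A B n) \<le> exp (K\<^sup>2 / (2 * r)) * exp (-1) ^ nat \<bar>n\<bar>" for n
  proof -
    define m :: real where "m = \<bar>of_int n\<bar>"
    have "(r / 2 + Re B) * of_int n \<le> \<bar>r / 2 + Re B\<bar> * m"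
      unfolding m_def by (metis abs_ge_self abs_mult)
    moreover have "m\<^sup>2 = (of_int n)\<^sup>2" by (simp add: m_def)
    ultimately have "Re A * of_int n * (of_int n - 1) / 2 + Re B * of_int n + m \<le> - r / 2 * m\<^sup>2 + K * m"
      by (simp add: K_def r_def field_simps power2_eq_square)
    also have "\<dots> \<le> K\<^sup>2 / (2 * r)"
    proof -
      have "0 \<le> (r * m - K)\<^sup>2" by simp
      then have "2 * r * (- r / 2 * m\<^sup>2 + K * m) \<le> K\<^sup>2"
        by (simp add: power2_eq_square algebra_simps)
      then show ?thesis using r by (simp add: pos_le_divide_eq mult.commute)
    qed
    finally have "Re A * of_int n * (of_int n - 1) / 2 + Re B * of_int n \<le> K\<^sup>2 / (2 * r) - m" by simp
    moreover have "exp (-1 :: real) ^ nat \<bar>n\<bar> = exp (- m)"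
      by (simp add: m_def flip: exp_of_nat_mult)
    ultimately show ?thesis
      by (simp add: norm_jterm flip: exp_add)
  qed
  moreover have "(\<lambda>n::int. exp (K\<^sup>2 / (2 * r)) * exp (-1) ^ nat \<bar>n\<bar>) summable_on UNIV"
    by (intro summable_on_cmult_right summable_on_power_nat_abs) auto
  ultimately show ?thesis
    using Infinite_Sum.abs_summable_on_comparison_test'[of "\<lambda>n::int. exp (K\<^sup>2 / (2 * r)) * exp (-1) ^ nat \<bar>n\<bar>" UNIV "jterm A B"]
    by blast
qed

lemma qfact_LIMSEQ:
  assumes "norm Q < 1"
  shows "qfact Q \<longlonglongrightarrow> qpoch Q Q"
  using qpoch_LIMSEQ[OF assms, of Q] by (simp add: qfact_def[abs_def])

text \<open>\<open>qfact Q\<close> converges to a nonzero limit, so it and its inverse are bounded.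
  A bound uniform in n and k is what dominated convergence requires.\<close>

lemma qbinomial_bounded:
  assumes "norm Q < 1"
  obtains C where "\<And>n k. norm (qbinomial Q n k) \<le> C"
proof -
  have "Bseq (qfact Q)"
    using qfact_LIMSEQ[OF assms] by (rule convergent_imp_Bseq[OF convergentI])
  then obtain C1 where C1: "C1 > 0" "\<And>n. norm (qfact Q n) \<le> C1"
    by (auto simp: Bseq_def)
  have "(\<lambda>n. inverse (qfact Q n)) \<longlonglongrightarrow> inverse (qpoch Q Q)"
    by (intro tendsto_inverse qfact_LIMSEQ qpoch_nonzero assms)
  then have "Bseq (\<lambda>n. inverse (qfact Q n))"
    by (rule convergent_imp_Bseq[OF convergentI])
  then obtain C2 where C2: "C2 > 0" "\<And>n. norm (inverse (qfact Q n)) \<le> C2"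
    by (auto simp: Bseq_def)
  show ?thesis
  proof
    fix n k
    have "norm (qbinomial Q n k) \<le> norm (qfact Q n * (inverse (qfact Q k) * inverse (qfact Q (n - k))))"
      by (simp add: qbinomial_def field_simps)
    also have "\<dots> \<le> C1 * (C2 * C2)"
      unfolding norm_mult using C1 C2 by (intro mult_mono) auto
    finally show "norm (qbinomial Q n k) \<le> C1 * (C2 * C2)" .
  qed
qed

lemma qbinomial_central_LIMSEQ:
  assumes "norm Q < 1"
  shows "(\<lambda>N. qbinomial Q (2 * N) (nat (j + int N))) \<longlonglongrightarrow> 1 / qpoch Q Q"
proof -
  have nz: "qpoch Q Q \<noteq> 0" by (intro qpoch_nonzero assms)
  have lim: "filterlim (\<lambda>N. nat (i + int N)) sequentially sequentially" for i
    unfolding filterlim_at_top eventually_sequentially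
  proof
    fix Z show "\<exists>N. \<forall>n\<ge>N. Z \<le> nat (i + int n)"
      by (rule exI[of _ "Z + nat \<bar>i\<bar>"]) auto
  qed
  have "filterlim (\<lambda>N::nat. 2 * N) sequentially sequentially"
    by (intro filterlim_subseq) (auto simp: strict_mono_def)
  then have "(\<lambda>N. qfact Q (2 * N) / (qfact Q (nat (j + int N)) * qfact Q (nat (- j + int N))))
      \<longlonglongrightarrow> qpoch Q Q / (qpoch Q Q * qpoch Q Q)"
    using nz by (intro tendsto_intros filterlim_compose[OF qfact_LIMSEQ[OF assms]] lim) auto
  moreover have "\<forall>\<^sub>F N in sequentially. qfact Q (2 * N) / (qfact Q (nat (j + int N)) * qfact Q (nat (- j + int N)))
      = qbinomial Q (2 * N) (nat (j + int N))"
    unfolding eventually_sequentially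
  proof (intro exI[of _ "nat \<bar>j\<bar>"] allI impI)
    fix N assume "nat \<bar>j\<bar> \<le> N"
    then have "2 * N - nat (j + int N) = nat (- j + int N)" "nat (j + int N) \<le> 2 * N" by auto
    then show "qfact Q (2 * N) / (qfact Q (nat (j + int N)) * qfact Q (nat (- j + int N)))
      = qbinomial Q (2 * N) (nat (j + int N))"
      by (simp add: qbinomial_def)
  qed
  ultimately show ?thesis using nz by (simp add: tendsto_cong)
qed

text \<open>Let N tend to infinity in \<open>finite_triple_product\<close>: each central q-binomial
  tends to 1 / \<open>qpoch Q Q\<close>, and Tannery's theorem permits the termwise limit. The
  integers are enumerated by \<open>int_decode\<close>, since that theorem is about series over
  nat.\<close>

theorem Jacobi_triple_product:
  assumes "Re A < 0"
  shows "(jterm A B has_sum jac (exp B) (exp A)) UNIV"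
proof -
  let ?Q = "exp A"
  have Q: "norm ?Q < 1" using assms by simp
  have nz: "qpoch ?Q ?Q \<noteq> 0" by (intro qpoch_nonzero Q)
  obtain C where C: "\<And>n k. norm (qbinomial ?Q n k) \<le> C" using qbinomial_bounded[OF Q] by blast
  have C0: "C \<ge> 0" using C[of 0 0] norm_ge_zero order_trans by blast
  \<comment> \<open>Extension by 0 beyond |j| = N turns the finite sums into series over one fixed
    index set.\<close>
  define a where "a j N = (if \<bar>j\<bar> \<le> int N then qbinomial ?Q (2 * N) (nat (j + int N)) else 0) * jterm A B j" for j N
  have bij: "bij int_decode" by (rule bij_int_decode)
  have a_sums: "(\<lambda>k. a (int_decode k) N) sums ((\<Prod>k<N. 1 - exp B * exp A ^ k) * (\<Prod>k<N. 1 - exp A / exp B * exp A ^ k))" for N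
  proof -
    have "((\<lambda>j. a j N) has_sum (\<Sum>j\<in>{-int N..int N}. a j N)) UNIV"
      by (rule has_sum_finite_neutralI) (auto simp: a_def)
    moreover have "(\<Sum>j\<in>{-int N..int N}. a j N) = (\<Prod>k<N. 1 - exp B * exp A ^ k) * (\<Prod>k<N. 1 - exp A / exp B * exp A ^ k)"
      unfolding finite_triple_product[OF assms] by (intro sum.cong refl) (auto simp: a_def)
    ultimately show ?thesis
      using has_sum_reindex_bij_betw[OF bij, of "\<lambda>j. a j N"] has_sum_imp_sums by metis
  qed
  have a_lim: "(\<lambda>N. a j N) \<longlonglongrightarrow> 1 / qpoch ?Q ?Q * jterm A B j" for j
  proof -
    have "\<forall>\<^sub>F N in sequentially. qbinomial ?Q (2 * N) (nat (j + int N)) * jterm A B j = a j N"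
      unfolding eventually_sequentially by (intro exI[of _ "nat \<bar>j\<bar>"]) (auto simp: a_def)
    then show ?thesis
      using tendsto_mult[OF qbinomial_central_LIMSEQ[OF Q, of j] tendsto_const[of "jterm A B j"]]
      by (simp add: tendsto_cong)
  qed
  have summ: "summable (\<lambda>k. C * norm (jterm A B (int_decode k)))"
    using abs_summable_jterm[OF assms] summable_on_reindex_bij_betw[OF bij, of "\<lambda>j. norm (jterm A B j)"]
    by (intro summable_mult summable_on_imp_summable) simp
  have l1: "(\<lambda>N. \<Sum>k. a (int_decode k) N) \<longlonglongrightarrow> (\<Sum>k. 1 / qpoch ?Q ?Q * jterm A B (int_decode k))"
  proof (rule tannerys_theorem[THEN conjunct2, THEN conjunct2])
    show "\<forall>\<^sub>F (k, n) in sequentially \<times>\<^sub>F sequentially. norm (a (int_decode k) n) \<le> C * norm (jterm A B (int_decode k))"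
      using C C0 by (intro always_eventually) (auto simp: a_def norm_mult intro!: mult_right_mono)
  qed (use a_lim summ in auto)
  have eq: "(\<Sum>k. a (int_decode k) N) = (\<Prod>k<N. 1 - exp B * exp A ^ k) * (\<Prod>k<N. 1 - exp A / exp B * exp A ^ k)" for N
    using a_sums[of N] by (simp add: sums_iff)
  have l2: "(\<lambda>N. (\<Prod>k<N. 1 - exp B * exp A ^ k) * (\<Prod>k<N. 1 - exp A / exp B * exp A ^ k))
     \<longlonglongrightarrow> qpoch (exp B) ?Q * qpoch (?Q / exp B) ?Q"
    by (intro tendsto_mult qpoch_LIMSEQ Q)
  have *: "(\<Sum>k. 1 / qpoch ?Q ?Q * jterm A B (int_decode k)) = qpoch (exp B) ?Q * qpoch (?Q / exp B) ?Q"
    by (rule LIMSEQ_unique[OF l1[unfolded eq] l2])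
  obtain S where S: "(jterm A B has_sum S) UNIV"
    using abs_summable_summable[OF abs_summable_jterm[OF assms]] by (auto simp: summable_on_def)
  then have "((\<lambda>k. jterm A B (int_decode k)) has_sum S) UNIV"
    using has_sum_reindex_bij_betw[OF bij, of "jterm A B"] by blast
  then have "(\<lambda>k. 1 / qpoch ?Q ?Q * jterm A B (int_decode k)) sums (1 / qpoch ?Q ?Q * S)"
    by (intro sums_mult has_sum_imp_sums)
  then have "S = jac (exp B) ?Q"
    using * nz by (simp add: sums_iff jac_def field_simps)
  then show ?thesis using S by simp
qed

subsection \<open>Products of theta series\<close>

lemma has_sum_times:
  fixes f :: "'a \<Rightarrow> complex" and g :: "'b \<Rightarrow> complex"
  assumes "(f has_sum F) A" "(g has_sum G) B"
    and "(\<lambda>x. norm (f x)) summable_on A" "(\<lambda>x. norm (g x)) summable_on B"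
  shows "((\<lambda>(x, y). f x * g y) has_sum (F * G)) (A \<times> B)"
proof (rule has_sum_SigmaI)
  show "((\<lambda>y. case (x, y) of (x, y) \<Rightarrow> f x * g y) has_sum f x * G) B" for x
    using assms by (simp add: has_sum_cmult_right)
  show "((\<lambda>x. f x * G) has_sum F * G) A"
    using assms by (simp add: has_sum_cmult_left)
  have "(\<lambda>p. norm (case p of (x, y) \<Rightarrow> f x * g y)) summable_on (A \<times> B)"
    unfolding Infinite_Sum.abs_summable_on_Sigma_iff
    using assms(3,4)
    by (auto simp: norm_mult abs_mult infsum_cmult_right' intro!: summable_on_cmult_right summable_on_cmult_left)
  then show "(\<lambda>(x, y). f x * g y) summable_on A \<times> B"
    by (rule abs_summable_summable)
qed

text \<open>Used for changes of summation variables: Z^2 or Z is cut into cosets of a sublattice,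
  each parametrised by an affine map.\<close>

lemma has_sum_partition_images:
  fixes f :: "'b \<Rightarrow> 'c :: topological_comm_monoid_add"
  assumes "finite I"
    and "\<And>i. i \<in> I \<Longrightarrow> ((\<lambda>x. f (\<phi> i x)) has_sum S i) UNIV"
    and "\<And>i x j y. i \<in> I \<Longrightarrow> j \<in> I \<Longrightarrow> \<phi> i x = \<phi> j y \<Longrightarrow> i = j \<and> x = y"
    and "\<And>y. \<exists>i\<in>I. \<exists>x. y = \<phi> i x"
  shows "(f has_sum (\<Sum>i\<in>I. S i)) UNIV"
proof -
  have "(f has_sum (\<Sum>i\<in>I. S i)) (\<Union>i\<in>I. range (\<phi> i))"
  proof (rule sum_has_sum[OF assms(1)])
    fix i assume i: "i \<in> I"
    have "inj (\<phi> i)" using assms(3)[OF i i] by (auto simp: inj_def)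
    then show "(f has_sum S i) (range (\<phi> i))"
      using assms(2)[OF i] by (simp add: has_sum_reindex o_def)
  next
    fix i j assume "i \<in> I" "j \<in> I" "i \<noteq> j"
    then show "range (\<phi> i) \<inter> range (\<phi> j) = {}" using assms(3)[of i j] by auto
  qed
  moreover have "(\<Union>i\<in>I. range (\<phi> i)) = UNIV" using assms(4) by blast
  ultimately show ?thesis by simp
qed

lemma powi_minus_one_eq: "even (m - n) \<Longrightarrow> (-1 :: complex) powi m = (-1) powi n"
  by (auto simp: power_int_minus_left)

lemma powi_minus_one_neq: "odd (m - n) \<Longrightarrow> (-1 :: complex) powi m = - ((-1) powi n)"
  by (auto simp: power_int_minus_left)

lemma jterm_mult:
  "jterm A B m * jterm A' B' n = (-1) powi (m + n) *
    exp (A * of_int m * (of_int m - 1) / 2 + B * of_int m + (A' * of_int n * (of_int n - 1) / 2 + B' * of_int n))"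
  unfolding jterm_def exp_add[of "_ + _" "_ + _"] by (simp add: power_int_add)

text \<open>Theta terms without alternating sign. They arise where a substitution makes the signs of
  two factors cancel, and they belong to \<open>jac\<close> at a negative argument.\<close>

definition pterm :: "complex \<Rightarrow> complex \<Rightarrow> int \<Rightarrow> complex" where
  "pterm A B n = exp (A * of_int n * (of_int n - 1) / 2 + B * of_int n)"

lemma pterm_eq_jterm: "pterm A B n = jterm A (B + of_real pi * \<i>) n"
proof -
  have "exp ((of_real pi * \<i>) * of_int n) = (-1 :: complex) powi n"
    by (metis exp_pi_i exp_power_int mult.commute)
  then have "exp (A * of_int n * (of_int n - 1) / 2 + (B + of_real pi * \<i>) * of_int n) = pterm A B n * (-1) powi n"
    by (simp add: pterm_def distrib_right flip: exp_add) (simp add: add.assoc exp_add)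
  moreover have "(-1 :: complex) powi n * (-1) powi n = 1"
    by (auto simp: power_int_minus_left)
  ultimately show ?thesis by (simp add: jterm_def mult_ac)
qed

lemma pterm_has_sum:
  assumes "Re A < 0"
  shows "(pterm A B has_sum jac (- exp B) (exp A)) UNIV"
  using Jacobi_triple_product[OF assms, of "B + of_real pi * \<i>"]
  by (simp add: exp_add pterm_eq_jterm[abs_def])

lemma abs_summable_pterm:
  assumes "Re A < 0"
  shows "(\<lambda>n. norm (pterm A B n)) summable_on UNIV"
  using abs_summable_jterm[OF assms, of "B + of_real pi * \<i>"] by (simp flip: pterm_eq_jterm)

text \<open>The substitution $(m, n) = (k + l, k - l + r)$ with $r \in \{0, 1\}$ separates the variables in the
  double series.\<close>

lemma jac_mult_exp:
  assumes A: "Re A < 0"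
  shows "jac (exp (X + Y)) (exp A) * jac (exp (X - Y)) (exp A)
     = jac (- exp (2 * X)) (exp (2 * A)) * jac (- exp (A + 2 * Y)) (exp (2 * A))
     - exp (X - Y) * (jac (- exp (A + 2 * X)) (exp (2 * A)) * jac (- exp (2 * Y)) (exp (2 * A)))"
proof -
  define f where "f = (\<lambda>(m, n). jterm A (X + Y) m * jterm A (X - Y) n)"
  define \<phi> :: "nat \<Rightarrow> int \<times> int \<Rightarrow> int \<times> int" where "\<phi> r = (\<lambda>(k, l). (k + l, k - l + int r))" for r
  define S where "S r = (if r = 0 then jac (- exp (2 * X)) (exp (2 * A)) * jac (- exp (A + 2 * Y)) (exp (2 * A))
     else - exp (X - Y) * (jac (- exp (A + 2 * X)) (exp (2 * A)) * jac (- exp (2 * Y)) (exp (2 * A))))" for r :: nat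
  have A2: "Re (2 * A) < 0" using A by simp
  have 1: "(f has_sum (jac (exp (X + Y)) (exp A) * jac (exp (X - Y)) (exp A))) UNIV"
    using has_sum_times[OF Jacobi_triple_product[OF A] Jacobi_triple_product[OF A] abs_summable_jterm[OF A] abs_summable_jterm[OF A]]
    by (simp add: f_def)
  have 2: "(f has_sum (\<Sum>r\<in>{0,1}. S r)) UNIV"
  proof (rule has_sum_partition_images)
    fix r assume "r \<in> {0, 1::nat}"
    then consider "r = 0" | "r = 1" by auto
    then show "((\<lambda>x. f (\<phi> r x)) has_sum S r) UNIV"
    proof cases
      case 1
      have "f (\<phi> 0 (k, l)) = pterm (2 * A) (2 * X) k * pterm (2 * A) (A + 2 * Y) l" for k l
      proof -
        have "(-1 :: complex) powi (k + l + (k - l)) = (-1) powi 0" by (rule powi_minus_one_eq) auto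
        then show ?thesis
          by (simp add: f_def \<phi>_def jterm_mult pterm_def field_simps flip: exp_add)
      qed
      then have "(\<lambda>x. f (\<phi> 0 x)) = (\<lambda>(k, l). pterm (2 * A) (2 * X) k * pterm (2 * A) (A + 2 * Y) l)" by auto
      then show ?thesis
        using has_sum_times[OF pterm_has_sum[OF A2] pterm_has_sum[OF A2] abs_summable_pterm[OF A2] abs_summable_pterm[OF A2]]
        by (simp add: 1 S_def)
    next
      case 2
      have "f (\<phi> 1 (k, l)) = - exp (X - Y) * (pterm (2 * A) (A + 2 * X) k * pterm (2 * A) (2 * Y) l)" for k l
      proof -
        have "(-1 :: complex) powi (k + l + (k - l + 1)) = - ((-1) powi 0)" by (rule powi_minus_one_neq) auto
        then show ?thesis
          by (simp add: f_def \<phi>_def jterm_mult pterm_def field_simps flip: exp_add)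
      qed
      then have "(\<lambda>x. f (\<phi> 1 x)) = (\<lambda>x. - exp (X - Y) * (case x of (k, l) \<Rightarrow> pterm (2 * A) (A + 2 * X) k * pterm (2 * A) (2 * Y) l))" by auto
      then show ?thesis
        using has_sum_cmult_right[OF has_sum_times[OF pterm_has_sum[OF A2] pterm_has_sum[OF A2] abs_summable_pterm[OF A2] abs_summable_pterm[OF A2]],
            of "- exp (X - Y)" "A + 2 * X" "2 * Y"]
        by (simp add: 2 S_def)
    qed
  next
    fix i x j y assume *: "i \<in> {0, 1::nat}" "j \<in> {0, 1::nat}" "\<phi> i x = \<phi> j y"
    obtain k l k' l' where "x = (k, l)" "y = (k', l')" by (metis surj_pair)
    with * show "i = j \<and> x = y" by (auto simp: \<phi>_def; presburger)
  next
    fix y :: "int \<times> int"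
    obtain m n where y: "y = (m, n)" by (metis surj_pair)
    show "\<exists>i\<in>{0,1}. \<exists>x. y = \<phi> i x"
    proof (cases "even (m + n)")
      case True
      then obtain k where "m + n = 2 * k" by blast
      then have "y = \<phi> 0 (k, m - k)" by (simp add: y \<phi>_def)
      then show ?thesis by blast
    next
      case False
      then obtain k where "m + n = 2 * k + 1" by (elim oddE)
      then have "y = \<phi> 1 (k, m - k)" by (simp add: y \<phi>_def)
      then show ?thesis by blast
    qed
  qed auto
  show ?thesis using has_sum_unique[OF 1 2] by (simp add: S_def)
qed

lemma jac_one:
  assumes "norm Q < 1"
  shows "jac 1 Q = 0"
proof -
  have "0 \<in> range (\<lambda>k. 1 - 1 * Q ^ k)" by (rule range_eqI[of _ _ 0]) simp
  then show ?thesis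
    using has_prod_eq_0_iff[OF qpoch_has_prod[OF assms, of 1]] by (simp add: jac_def)
qed

text \<open>The three factors of \<open>jac\<close> are the residue classes modulo 3 of Euler's
  product. With the triple product this is the pentagonal number theorem.\<close>

lemma jac_inverse_cube:
  assumes "norm p < 1" "p \<noteq> 0"
  shows "jac p (p ^ 3) = qpoch p p" "jac (p ^ 2) (p ^ 3) = qpoch p p"
  using qpoch_split[OF assms(1), of 3 p] assms(2)
  by (simp_all add: jac_def eval_nat_numeral lessThan_Suc mult_ac)

text \<open>The substitution $(m, n') = (k - 2n + r, n + k)$ with $r \in \{0, 1, 2\}$ groups the double series
  by the exponent $3k + r$ of $e^B$; the class $r = 2$ contributes the factor \<open>jac 1\<close>, which is 0.\<close>

lemma quintuple_exp:
  assumes A: "Re A < 0"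
  shows "jac (exp B) (exp A) * jac (exp (A + 2 * B)) (exp (2 * A))
    = qpoch (exp (2 * A)) (exp (2 * A)) * (jac (- exp (A + 3 * B)) (exp (3 * A)) - exp B * jac (- exp (2 * A + 3 * B)) (exp (3 * A)))"
proof -
  define f where "f = (\<lambda>(m, n). jterm A B m * jterm (2 * A) (A + 2 * B) n)"
  define \<phi> :: "nat \<Rightarrow> int \<times> int \<Rightarrow> int \<times> int" where "\<phi> r = (\<lambda>(k, n). (k - 2 * n + int r, n + k))" for r
  \<comment> \<open>In the classes r = 0 and r = 1 the inner sum is a theta constant of nome exp(6A)
    at exp(4A) and exp(2A). Both collapse to this Euler product.\<close>
  define P where "P = qpoch (exp (2 * A)) (exp (2 * A))"
  define S where "S r = (if r = 0 then jac (- exp (A + 3 * B)) (exp (3 * A)) * P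
     else if r = 1 then - exp B * (jac (- exp (2 * A + 3 * B)) (exp (3 * A)) * P) else 0)" for r :: nat
  have A': "Re (2 * A) < 0" "Re (3 * A) < 0" "Re (6 * A) < 0" using A by simp_all
  have "exp (6 * A) = exp (2 * A) ^ 3" "exp (4 * A) = exp (2 * A) ^ 2"
    by (simp_all flip: exp_of_nat_mult)
  then have P: "jac (exp (4 * A)) (exp (6 * A)) = P" "jac (exp (2 * A)) (exp (6 * A)) = P"
    using jac_inverse_cube[of "exp (2 * A)"] A by (simp_all add: P_def)
  have 1: "(f has_sum (jac (exp B) (exp A) * jac (exp (A + 2 * B)) (exp (2 * A)))) UNIV"
    using has_sum_times[OF Jacobi_triple_product[OF A] Jacobi_triple_product[OF A'(1)] abs_summable_jterm[OF A] abs_summable_jterm[OF A'(1)]]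
    by (simp add: f_def)
  note sums = has_sum_times[OF pterm_has_sum[OF A'(2)] Jacobi_triple_product[OF A'(3)] abs_summable_pterm[OF A'(2)] abs_summable_jterm[OF A'(3)]]
  have 2: "(f has_sum (\<Sum>r\<in>{0,1,2}. S r)) UNIV"
  proof (rule has_sum_partition_images)
    fix r assume "r \<in> {0, 1, 2::nat}"
    then consider "r = 0" | "r = 1" | "r = 2" by auto
    then show "((\<lambda>x. f (\<phi> r x)) has_sum S r) UNIV"
    proof cases
      case 1
      have "f (\<phi> 0 (k, n)) = pterm (3 * A) (A + 3 * B) k * jterm (6 * A) (4 * A) n" for k n
      proof -
        have "(-1 :: complex) powi (k - 2 * n + (n + k)) = (-1) powi n" by (rule powi_minus_one_eq) auto
        then show ?thesis
          by (simp add: f_def \<phi>_def jterm_mult)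
             (simp add: jterm_def pterm_def flip: exp_add, rule arg_cong[of _ _ exp], simp add: field_simps)
      qed
      then have "(\<lambda>x. f (\<phi> 0 x)) = (\<lambda>(k, n). pterm (3 * A) (A + 3 * B) k * jterm (6 * A) (4 * A) n)" by auto
      then show ?thesis
        using sums[of "A + 3 * B" "4 * A"] by (simp add: 1 S_def P)
    next
      case 2
      have "f (\<phi> 1 (k, n)) = - exp B * (pterm (3 * A) (2 * A + 3 * B) k * jterm (6 * A) (2 * A) n)" for k n
      proof -
        have "(-1 :: complex) powi (k - 2 * n + 1 + (n + k)) = - ((-1) powi n)" by (rule powi_minus_one_neq) auto
        then show ?thesis
          by (simp add: f_def \<phi>_def jterm_mult)
             (simp add: jterm_def pterm_def flip: exp_add, rule arg_cong[of _ _ exp], simp add: field_simps)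
      qed
      then have "(\<lambda>x. f (\<phi> 1 x)) = (\<lambda>x. - exp B * (case x of (k, n) \<Rightarrow> pterm (3 * A) (2 * A + 3 * B) k * jterm (6 * A) (2 * A) n))" by auto
      then show ?thesis
        using has_sum_cmult_right[OF sums[of "2 * A + 3 * B" "2 * A"], of "- exp B"]
        by (simp add: 2 S_def P)
    next
      case 3
      have "f (\<phi> 2 (k, n)) = exp (A + 2 * B) * (pterm (3 * A) (3 * A + 3 * B) k * jterm (6 * A) 0 n)" for k n
      proof -
        have "(-1 :: complex) powi (k - 2 * n + 2 + (n + k)) = (-1) powi n" by (rule powi_minus_one_eq) auto
        then show ?thesis
          by (simp add: f_def \<phi>_def jterm_mult)
             (simp add: jterm_def pterm_def flip: exp_add, rule arg_cong[of _ _ exp], simp add: field_simps)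
      qed
      then have "(\<lambda>x. f (\<phi> 2 x)) = (\<lambda>x. exp (A + 2 * B) * (case x of (k, n) \<Rightarrow> pterm (3 * A) (3 * A + 3 * B) k * jterm (6 * A) 0 n))" by auto
      then show ?thesis
        using has_sum_cmult_right[OF sums[of "3 * A + 3 * B" 0], of "exp (A + 2 * B)"] A
        by (simp add: 3 S_def jac_one)
    qed
  next
    fix i x j y assume *: "i \<in> {0, 1, 2::nat}" "j \<in> {0, 1, 2::nat}" "\<phi> i x = \<phi> j y"
    obtain k l k' l' where "x = (k, l)" "y = (k', l')" by (metis surj_pair)
    with * show "i = j \<and> x = y" by (auto simp: \<phi>_def; presburger)
  next
    fix y :: "int \<times> int"
    obtain m n where y: "y = (m, n)" by (metis surj_pair)
    \<comment> \<open>The coefficient of B in the exponent is m + 2n = 3k + r, so division by 3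
      recovers k and r.\<close>
    define s where "s = m + 2 * n"
    define r where "r = nat (s mod 3)"
    have "s = 3 * (s div 3) + int r" "r \<in> {0, 1, 2}" unfolding r_def by auto
    then have "y = \<phi> r (s div 3, n - s div 3)" by (simp add: y \<phi>_def s_def)
    then show "\<exists>i\<in>{0,1,2}. \<exists>x. y = \<phi> i x" using \<open>r \<in> _\<close> by blast
  qed auto
  show ?thesis using has_sum_unique[OF 1 2] by (simp add: S_def P_def algebra_simps)
qed

section \<open>Theta identities in multiplicative variables; Klein quartic and 7-dissection\<close>

lemma jac_sym: "Q \<noteq> 0 \<Longrightarrow> jac (Q / z) Q = jac z Q"
  by (simp add: jac_def)

lemma jac_mult_jac:
  assumes "norm Q < 1" "Q \<noteq> 0" "x \<noteq> 0" "y \<noteq> 0"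
  shows "jac (x * y) Q * jac (x / y) Q
       = jac (- (x ^ 2)) (Q ^ 2) * jac (- Q * y ^ 2) (Q ^ 2) - x / y * (jac (- Q * x ^ 2) (Q ^ 2) * jac (- (y ^ 2)) (Q ^ 2))"
proof -
  define A X Y where "A = Ln Q" and "X = Ln x" and "Y = Ln y"
  have e: "exp A = Q" "exp X = x" "exp Y = y" using assms by (auto simp: A_def X_def Y_def)
  have "Re A < 0" using assms e(1) norm_exp_eq_Re[of A] by simp
  from jac_mult_exp[OF this, of X Y] show ?thesis
    by (simp add: exp_add exp_diff exp_double e)
qed

lemma quintuple_product:
  assumes "norm p < 1" "p \<noteq> 0" "z \<noteq> 0"
  shows "jac z p * jac (z ^ 2 * p) (p ^ 2)
       = qpoch (p ^ 2) (p ^ 2) * (jac (- p * z ^ 3) (p ^ 3) - z * jac (- (p ^ 2) * z ^ 3) (p ^ 3))"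
proof -
  define A B where "A = Ln p" and "B = Ln z"
  have e: "exp A = p" "exp B = z" using assms by (auto simp: A_def B_def)
  have e3: "exp (3 * x) = exp x ^ 3" for x :: complex
    by (simp flip: exp_of_nat_mult)
  have "Re A < 0" using assms e(1) norm_exp_eq_Re[of A] by simp
  from quintuple_exp[OF this, of B] show ?thesis
    by (simp add: exp_add exp_double e3 e) (simp add: mult.commute)
qed

lemma qpoch_square:
  assumes "norm p < 1"
  shows "qpoch y p * qpoch (- y) p = qpoch (y ^ 2) (p ^ 2)"
proof (rule LIMSEQ_unique)
  have "norm (p ^ 2) < 1" using assms by (simp add: norm_power power_less_one_iff)
  then show "(\<lambda>n. \<Prod>k<n. 1 - y ^ 2 * (p ^ 2) ^ k) \<longlonglongrightarrow> qpoch (y ^ 2) (p ^ 2)"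
    by (rule qpoch_LIMSEQ)
  have "(\<Prod>k<n. 1 - y ^ 2 * (p ^ 2) ^ k) = (\<Prod>k<n. 1 - y * p ^ k) * (\<Prod>k<n. 1 - - y * p ^ k)" for n
    unfolding prod.distrib[symmetric]
    by (intro prod.cong refl) (simp add: algebra_simps power2_eq_square power_mult_distrib)
  then show "(\<lambda>n. \<Prod>k<n. 1 - y ^ 2 * (p ^ 2) ^ k) \<longlonglongrightarrow> qpoch y p * qpoch (- y) p"
    by (simp only:) (intro tendsto_mult qpoch_LIMSEQ assms)
qed

text \<open>(y^2; p) splits by parity into (y^2; p^2) and (y^2 p; p^2), and the former is (y; p)(-y;
  p); likewise for p / y^2. This removes the nome p^2 from the quintuple product.\<close>

lemma jac_square:
  assumes "norm p < 1" "p \<noteq> 0" "y \<noteq> 0"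
  shows "jac y p * jac (- y) p * jac (y ^ 2 * p) (p ^ 2) = jac (y ^ 2) p * qpoch p p * qpoch (p ^ 2) (p ^ 2)"
proof -
  have s: "qpoch w p = qpoch w (p ^ 2) * qpoch (w * p) (p ^ 2)" for w
    using qpoch_split[OF assms(1), of 2 w] by (simp add: numeral_2_eq_2)
  have 1: "qpoch (y ^ 2) p = qpoch y p * qpoch (- y) p * qpoch (y ^ 2 * p) (p ^ 2)"
    by (subst s) (simp add: qpoch_square[OF assms(1)])
  have 2: "qpoch (p / y ^ 2) p = qpoch (p / y ^ 2) (p ^ 2) * (qpoch (p / y) p * qpoch (p / - y) p)"
    using qpoch_square[OF assms(1), of "p / y"]
    by (subst s) (simp add: power2_eq_square)
  have "p ^ 2 / (y ^ 2 * p) = p / y ^ 2" using assms by (simp add: power2_eq_square)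
  then show ?thesis
    unfolding jac_def 1 2 by (simp add: mult_ac)
qed

text \<open>The quintuple product at z = -y, multiplied by \<open>jac y p\<close> and simplified by
  \<open>jac_square\<close>. It expresses a sum of two thetas of nome p^3 by the quotient of thetas
  at y^2 and y, as the dissection requires.\<close>

lemma quintuple_product_quotient:
  assumes "norm p < 1" "p \<noteq> 0" "y \<noteq> 0"
  shows "jac y p * (jac (p * y ^ 3) (p ^ 3) + y * jac (p ^ 2 * y ^ 3) (p ^ 3)) = jac (y ^ 2) p * qpoch p p"
proof -
  have "norm (p ^ 2) < 1" using assms by (simp add: norm_power power_less_one_iff)
  then have nz: "qpoch (p ^ 2) (p ^ 2) \<noteq> 0" by (intro qpoch_nonzero)
  have "jac (- y) p * jac (y ^ 2 * p) (p ^ 2) = qpoch (p ^ 2) (p ^ 2) * (jac (p * y ^ 3) (p ^ 3) + y * jac (p ^ 2 * y ^ 3) (p ^ 3))"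
    using quintuple_product[OF assms(1,2), of "- y"] assms(3) by simp
  then have "qpoch (p ^ 2) (p ^ 2) * (jac y p * (jac (p * y ^ 3) (p ^ 3) + y * jac (p ^ 2 * y ^ 3) (p ^ 3)))
      = qpoch (p ^ 2) (p ^ 2) * (jac (y ^ 2) p * qpoch p p)"
    using jac_square[OF assms] by (simp add: mult_ac)
  then show ?thesis using nz by simp
qed

text \<open>The Klein quartic is the Pluecker relation for the $2 \times 4$ matrix with columns
  $(a(q^k), b(q^k))$, $k = 0, 1, 2, 3$, whose minors are products of two theta values.\<close>

lemma klein_quartic_jac:
  assumes "norm q < 1" "q \<noteq> 0"
  defines "T \<equiv> \<lambda>k::nat. jac (q ^ k) (q ^ 7)"
  shows "T 3 ^ 3 * T 1 - T 2 ^ 3 * T 3 + q * T 1 ^ 3 * T 2 = 0"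
proof -
  \<comment> \<open>The factor 1 / q^k in \<open>a\<close> absorbs the x / y of
    \<open>jac_mult_jac\<close>, so that a product of two thetas is q^m times a determinant.\<close>
  define a b where "a k = jac (- ((q ^ k) ^ 2)) ((q ^ 7) ^ 2) / q ^ k"
    and "b k = jac (- (q ^ 7) * (q ^ k) ^ 2) ((q ^ 7) ^ 2)" for k
  have Q: "norm (q ^ 7) < 1" "q ^ 7 \<noteq> 0" using assms by (simp_all add: norm_power power_less_one_iff)
  have prod: "T (m + k) * T (m - k) = q ^ m * (a m * b k - b m * a k)" if "k \<le> m" for m k
  proof -
    have d: "q ^ (m - k) = q ^ m / q ^ k" using assms(2) that by (simp add: power_diff)
    have "T (m + k) * T (m - k) = jac (- ((q ^ m) ^ 2)) ((q ^ 7) ^ 2) * b k - q ^ m / q ^ k * (b m * jac (- ((q ^ k) ^ 2)) ((q ^ 7) ^ 2))"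
      using jac_mult_jac[OF Q, of "q ^ m" "q ^ k"] assms(2)
      unfolding T_def b_def d power_add by simp
    also have "\<dots> = q ^ m * (a m * b k - b m * a k)"
      using assms(2) by (simp add: a_def right_diff_distrib)
    finally show ?thesis .
  qed
  \<comment> \<open>The index sums m + k reach 5; reflection folds them back to 1, 2, 3.\<close>
  have sym: "T 5 = T 2" "T 4 = T 3"
    using jac_sym[OF Q(2), of "q ^ 5"] jac_sym[OF Q(2), of "q ^ 4"] assms(2)
    by (simp_all add: T_def flip: power_diff)
  define W where "W m k = a m * b k - b m * a k" for m k
  have "W 3 2 * W 1 0 - W 3 1 * W 2 0 + W 3 0 * W 2 1 = 0"
    by (simp add: W_def algebra_simps)
  moreover have "T 2 * T 1 = q ^ 3 * W 3 2" "T 1 * T 1 = q * W 1 0" "T 3 * T 2 = q ^ 3 * W 3 1"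
     "T 2 * T 2 = q ^ 2 * W 2 0" "T 3 * T 3 = q ^ 3 * W 3 0" "T 3 * T 1 = q ^ 2 * W 2 1"
    using prod[of 2 3] prod[of 0 1] prod[of 1 3] prod[of 0 2] prod[of 0 3] prod[of 1 2] sym
    by (simp_all add: W_def)
  ultimately have "q * (T 2 * T 1) * (T 1 * T 1) - (T 3 * T 2) * (T 2 * T 2) + (T 3 * T 3) * (T 3 * T 1) = 0"
    by (simp only:) algebra
  then show ?thesis by (simp add: eval_nat_numeral algebra_simps)
qed

text \<open>Euler's pentagonal series is split by n mod 7 into seven thetas of nome t^147. Six of
  them pair up by the quintuple product into theta quotients; the class of -1 is an Euler product by
  itself and gives the term -t^2.\<close>

lemma euler_dissection:
  fixes t :: complex
  assumes t: "norm t < 1" "t \<noteq> 0"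
  defines "q \<equiv> t ^ 7"
  defines "T \<equiv> \<lambda>k::nat. jac (q ^ k) (q ^ 7)"
  assumes nz: "T 1 \<noteq> 0" "T 2 \<noteq> 0" "T 3 \<noteq> 0"
  shows "qpoch t t = qpoch (q ^ 7) (q ^ 7) * (T 2 / T 1 - t * (T 3 / T 2) - t ^ 2 + t ^ 5 * (T 1 / T 3))"
proof -
  define C where "C = Ln t"
  have C: "exp C = t" using t by (simp add: C_def)
  have re: "Re C < 0" using assms C norm_exp_eq_Re[of C] by simp
  have e: "exp (of_nat k * C) = t ^ k" for k by (simp add: exp_of_nat_mult C)
  define J where "J k = jac (t ^ k) (t ^ 147)" for k :: nat
  \<comment> \<open>Residues -4, ..., 2. Taking -4 instead of 3 produces
    \<open>t ^ 26 * J 161\<close>, the exact partner of \<open>t ^ 5 * J 112\<close> in the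
    quintuple product.\<close>
  define r :: "nat \<Rightarrow> int" where "r i = int i - 4" for i
  define S where "S i = (-1) powi r i * exp (C * (of_int (r i) * (3 * of_int (r i) - 1) / 2)) *
      jac (exp (C * (70 + 21 * of_int (r i)))) (t ^ 147)" for i
  have re': "Re (3 * C) < 0" "Re (147 * C) < 0" using re by simp_all
  have e147: "exp (147 * C) = t ^ 147" using e[of 147] by simp
  have F: "jac t (t ^ 3) = qpoch t t" using jac_inverse_cube[OF t] by simp
  \<comment> \<open>The exponent of t is n(3n - 1)/2, a generalised pentagonal number.\<close>
  have 1: "(jterm (3 * C) C has_sum qpoch t t) UNIV"
    using Jacobi_triple_product[OF re'(1), of C] e[of 3] by (simp add: C F)
  have 2: "(jterm (3 * C) C has_sum (\<Sum>i<7. S i)) UNIV"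
  proof (rule has_sum_partition_images[of _ _ "\<lambda>i m. 7 * m + r i"])
    fix i :: nat
    have "jterm (3 * C) C (7 * m + r i) = (-1) powi r i * exp (C * (of_int (r i) * (3 * of_int (r i) - 1) / 2)) *
       jterm (147 * C) (C * (70 + 21 * of_int (r i))) m" for m
    proof -
      have "(-1 :: complex) powi (7 * m + r i) = (-1) powi (r i + m)" by (rule powi_minus_one_eq) auto
      moreover have "3 * C * of_int (7 * m + r i) * (of_int (7 * m + r i) - 1) / 2 + C * of_int (7 * m + r i)
        = C * (of_int (r i) * (3 * of_int (r i) - 1) / 2) +
          (147 * C * of_int m * (of_int m - 1) / 2 + C * (70 + 21 * of_int (r i)) * of_int m)"
        by (simp add: field_simps)
      ultimately show ?thesis
        unfolding jterm_def by (simp only: exp_add power_int_add mult_ac) (simp add: power_int_add mult_ac)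
    qed
    then show "((\<lambda>m. jterm (3 * C) C (7 * m + r i)) has_sum S i) UNIV"
      using has_sum_cmult_right[OF Jacobi_triple_product[OF re'(2)]] by (simp add: S_def e147)
  next
    fix i x j y assume "i \<in> {..<7::nat}" "j \<in> {..<7::nat}" "7 * x + r i = 7 * y + r j"
    then show "i = j \<and> x = y" unfolding r_def lessThan_iff by presburger
  next
    fix y :: int
    have "7 * ((y + 4) div 7) + (y + 4) mod 7 = y + 4" by (rule mult_div_mod_eq)
    moreover have "int (nat ((y + 4) mod 7)) = (y + 4) mod 7" by simp
    ultimately have "y = 7 * ((y + 4) div 7) + r (nat ((y + 4) mod 7))"
      unfolding r_def by linarith
    moreover have "nat ((y + 4) mod 7) \<in> {..<7}" by auto
    ultimately show "\<exists>i\<in>{..<7}. \<exists>x. y = 7 * x + r i" by blast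
  qed auto
  have sym: "J (147 - k) = J k" if "k \<le> 147" for k
    using jac_sym[of "t ^ 147" "t ^ k"] t that by (simp add: J_def power_diff)
  have Sm4: "S 0 = t ^ 26 * J 161"
  proof -
    have "exp (- (14 * C)) = t ^ 147 / t ^ 161"
      using e[of 14] t by (simp add: exp_minus field_simps flip: power_add)
    then show ?thesis using jac_sym[of "t ^ 147" "t ^ 161"] e[of 26] t by (simp add: S_def r_def J_def mult.commute)
  qed
  have S: "S 1 = - (t ^ 15) * J 140" "S 2 = t ^ 7 * J 119" "S 3 = - (t ^ 2) * J 49" "S 4 = J 70"
     "S 5 = - t * J 91" "S 6 = t ^ 5 * J 112"
    using e[of 15] e[of 7] e[of 2] e[of 28] e[of 49] e[of 70] e[of 91] e[of 112] e[of 5] sym[of 7] sym[of 28] C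
    by (simp_all add: S_def r_def J_def mult.commute power_int_minus)
  define p where "p = t ^ 49"
  have p: "norm p < 1" "p \<noteq> 0" using t by (simp_all add: p_def norm_power power_less_one_iff)
  have qp: "q ^ 7 = p" by (simp add: p_def q_def flip: power_mult)
  have J49: "J 49 = qpoch p p"
    using jac_inverse_cube(1)[OF p] by (simp add: J_def p_def flip: power_mult)
  \<comment> \<open>Quintuple product with p = t^49 and y = t^(7k); k = 1, 2, 3 yield the three
    pairs after the indices 4 and 6 on the right are reflected.\<close>
  have Q: "T k * (J (49 + 21 * k) + t ^ (7 * k) * J (98 + 21 * k)) = T (2 * k) * qpoch p p" for k
    using quintuple_product_quotient[OF p, of "q ^ k"] t
    unfolding T_def qp J_def by (simp add: p_def q_def mult_ac add_ac flip: power_mult power_add)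
  have "T 6 = T 1" "T 4 = T 3"
    using jac_sym[of p "q ^ 6"] jac_sym[of p "q ^ 4"] p t
    by (simp_all add: T_def qp[symmetric] q_def flip: power_diff)
  then have "T 1 * (J 70 + t ^ 7 * J 119) = T 2 * qpoch p p"
    "T 2 * (J 91 + t ^ 14 * J 140) = T 3 * qpoch p p" "T 3 * (J 112 + t ^ 21 * J 161) = T 1 * qpoch p p"
    using Q[of 1] Q[of 2] Q[of 3] unfolding mult_1_right numeral_2_eq_2[symmetric] by (simp_all del: One_nat_def)
  then have "J 70 + t ^ 7 * J 119 = qpoch p p * (T 2 / T 1)"
    "J 91 + t ^ 14 * J 140 = qpoch p p * (T 3 / T 2)"
    "J 112 + t ^ 21 * J 161 = qpoch p p * (T 1 / T 3)"
    using nz by (simp_all add: field_simps)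
  moreover have "qpoch t t = (J 70 + t ^ 7 * J 119) - t * (J 91 + t ^ 14 * J 140) - t ^ 2 * J 49 + t ^ 5 * (J 112 + t ^ 21 * J 161)"
    using has_sum_unique[OF 1 2] S Sm4 by (simp add: eval_nat_numeral lessThan_Suc algebra_simps)
  ultimately show ?thesis by (simp add: J49 qp algebra_simps)
qed

subsection \<open>Norms over seventh roots of unity\<close>

text \<open>The \<open>c\<close>'s below are the roots of $c^3 + c^2 - 2c - 1$, i.e. the Gaussian periods
  $\omega^j + \omega^{-j}$ of a primitive seventh root of unity.\<close>

lemma cubic_norm_form:
  fixes d0 d1 d2 :: "'a :: comm_ring_1"
  assumes "c1 + c2 + c3 = -1" "c1 * c2 + c1 * c3 + c2 * c3 = -2" "c1 * c2 * c3 = 1"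
  shows "(d0 + d1 * c1 + d2 * c1 ^ 2) * (d0 + d1 * c2 + d2 * c2 ^ 2) * (d0 + d1 * c3 + d2 * c3 ^ 2)
    = d0 ^ 3 - d0 ^ 2 * d1 + 5 * d0 ^ 2 * d2 - 2 * d0 * d1 ^ 2 - d0 * d1 * d2 + 6 * d0 * d2 ^ 2
      + d1 ^ 3 - d1 ^ 2 * d2 - 2 * d1 * d2 ^ 2 + d2 ^ 3"
proof -
  define e1 e2 e3 where "e1 = c1 + c2 + c3" and "e2 = c1 * c2 + c1 * c3 + c2 * c3" and "e3 = c1 * c2 * c3"
  have "(d0 + d1 * c1 + d2 * c1 ^ 2) * (d0 + d1 * c2 + d2 * c2 ^ 2) * (d0 + d1 * c3 + d2 * c3 ^ 2)
    = d0 ^ 3 + d0 ^ 2 * d1 * e1 + d0 ^ 2 * d2 * (e1 ^ 2 - 2 * e2) + d0 * d1 ^ 2 * e2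
      + d0 * d1 * d2 * (e1 * e2 - 3 * e3) + d0 * d2 ^ 2 * (e2 ^ 2 - 2 * e1 * e3)
      + d1 ^ 3 * e3 + d1 ^ 2 * d2 * (e3 * e1) + d1 * d2 ^ 2 * (e3 * e2) + d2 ^ 3 * e3 ^ 2"
    unfolding e1_def e2_def e3_def
    by (simp add: power2_eq_square power3_eq_cube algebra_simps)
  moreover have "e1 = -1" "e2 = -2" "e3 = 1" using assms by (simp_all add: e1_def e2_def e3_def)
  ultimately show ?thesis by simp
qed

lemma root7_sum:
  fixes w :: complex
  assumes "w ^ 7 = 1" "w \<noteq> 1"
  shows "1 + w + w ^ 2 + w ^ 3 + w ^ 4 + w ^ 5 + w ^ 6 = 0"
proof -
  have "(w - 1) * (1 + w + w ^ 2 + w ^ 3 + w ^ 4 + w ^ 5 + w ^ 6) = w ^ 7 - 1" by algebra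
  then show ?thesis using assms by simp
qed

context
  fixes \<omega> :: complex
  assumes root: "\<omega> ^ 7 = 1" "\<omega> \<noteq> 1"
begin

lemma root7_periods:
  "(\<omega> + \<omega> ^ 6) + (\<omega> ^ 2 + \<omega> ^ 5) + (\<omega> ^ 3 + \<omega> ^ 4) = -1"
  "(\<omega> + \<omega> ^ 6) * (\<omega> ^ 2 + \<omega> ^ 5) + (\<omega> + \<omega> ^ 6) * (\<omega> ^ 3 + \<omega> ^ 4) + (\<omega> ^ 2 + \<omega> ^ 5) * (\<omega> ^ 3 + \<omega> ^ 4) = -2"
  "(\<omega> + \<omega> ^ 6) * (\<omega> ^ 2 + \<omega> ^ 5) * (\<omega> ^ 3 + \<omega> ^ 4) = 1"
  using root7_sum[OF root] root(1) by algebra+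

text \<open>Pairing w with its inverse w^6 puts the product into the real cubic subfield as a
  polynomial in the period w + w^6 with coefficients free of w. The three pairs are conjugate, so
  one expansion for generic w suffices.\<close>

lemma prod_root7:
  fixes f :: "complex \<Rightarrow> complex"
  assumes "\<And>w. w ^ 7 = 1 \<Longrightarrow> w \<noteq> 1 \<Longrightarrow> f w * f (w ^ 6) = d0 + d1 * (w + w ^ 6) + d2 * (w + w ^ 6) ^ 2"
  shows "(\<Prod>j<7. f (\<omega> ^ j)) = f 1 * (d0 ^ 3 - d0 ^ 2 * d1 + 5 * d0 ^ 2 * d2 - 2 * d0 * d1 ^ 2 - d0 * d1 * d2
      + 6 * d0 * d2 ^ 2 + d1 ^ 3 - d1 ^ 2 * d2 - 2 * d1 * d2 ^ 2 + d2 ^ 3)"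
proof -
  have *: "(\<omega> ^ k) ^ 7 = 1" for k using root(1) by (metis mult.commute power_mult power_one)
  have "\<omega> ^ 2 \<noteq> 1"
  proof
    assume "\<omega> ^ 2 = 1"
    then have "\<omega> = 1" using root(1) by algebra
    then show False using root by simp
  qed
  moreover have "\<omega> ^ 3 \<noteq> 1"
  proof
    assume "\<omega> ^ 3 = 1"
    then have "\<omega> = 1" using root(1) by algebra
    then show False using root by simp
  qed
  moreover have "(\<omega> ^ 2) ^ 6 = \<omega> ^ 5" "(\<omega> ^ 3) ^ 6 = \<omega> ^ 4" using root(1) by algebra+
  ultimately have "f \<omega> * f (\<omega> ^ 6) = d0 + d1 * (\<omega> + \<omega> ^ 6) + d2 * (\<omega> + \<omega> ^ 6) ^ 2"
    "f (\<omega> ^ 2) * f (\<omega> ^ 5) = d0 + d1 * (\<omega> ^ 2 + \<omega> ^ 5) + d2 * (\<omega> ^ 2 + \<omega> ^ 5) ^ 2"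
    "f (\<omega> ^ 3) * f (\<omega> ^ 4) = d0 + d1 * (\<omega> ^ 3 + \<omega> ^ 4) + d2 * (\<omega> ^ 3 + \<omega> ^ 4) ^ 2"
    using assms[OF root] assms[OF *[of 2]] assms[OF *[of 3]] by simp_all
  then have "f 1 * ((f \<omega> * f (\<omega> ^ 6)) * (f (\<omega> ^ 2) * f (\<omega> ^ 5)) * (f (\<omega> ^ 3) * f (\<omega> ^ 4)))
    = f 1 * (d0 ^ 3 - d0 ^ 2 * d1 + 5 * d0 ^ 2 * d2 - 2 * d0 * d1 ^ 2 - d0 * d1 * d2
      + 6 * d0 * d2 ^ 2 + d1 ^ 3 - d1 ^ 2 * d2 - 2 * d1 * d2 ^ 2 + d2 ^ 3)"
    by (simp only: cubic_norm_form[OF root7_periods])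
  moreover have "(\<Prod>j<7. f (\<omega> ^ j)) = f 1 * ((f \<omega> * f (\<omega> ^ 6)) * (f (\<omega> ^ 2) * f (\<omega> ^ 5)) * (f (\<omega> ^ 3) * f (\<omega> ^ 4)))"
    by (simp add: eval_nat_numeral lessThan_Suc mult_ac)
  ultimately show ?thesis by simp
qed

lemma prod_one_minus_root7: "(\<Prod>j<7. 1 - \<omega> ^ j * z) = 1 - z ^ 7"
proof -
  have "(1 - w * z) * (1 - w ^ 6 * z) = (1 + z ^ 2) + (- z) * (w + w ^ 6) + 0 * (w + w ^ 6) ^ 2"
    if "w ^ 7 = 1" for w :: complex
    using that by algebra
  from prod_root7[of "\<lambda>w. 1 - w * z", OF this]
  have "(\<Prod>j<7. 1 - \<omega> ^ j * z) = (1 - z) * ((1 + z ^ 2) ^ 3 + (1 + z ^ 2) ^ 2 * z - 2 * (1 + z ^ 2) * z ^ 2 - z ^ 3)"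
    by simp
  also have "\<dots> = 1 - z ^ 7" by algebra
  finally show ?thesis .
qed

text \<open>The product is invariant under x -> \<omega> x, which is why only powers of x^7
  survive.\<close>

lemma prod_quintic_root7:
  fixes h x :: complex
  defines "P \<equiv> \<lambda>y. y ^ 5 - h * y ^ 4 - h * y ^ 3 + h ^ 2"
  shows "(\<Prod>j<7. P (\<omega> ^ j * x)) = (x ^ 7) ^ 5 + (7 * h ^ 3 - 14 * h ^ 5 - 7 * h ^ 6 - h ^ 7) * (x ^ 7) ^ 4
    + (14 * h ^ 6 - 8 * h ^ 7) * (x ^ 7) ^ 3 + 14 * h ^ 10 * (x ^ 7) ^ 2 - 7 * h ^ 12 * x ^ 7 + h ^ 14"
proof -
  \<comment> \<open>\<open>E1\<close>, \<open>E2\<close>, \<open>E3\<close> are the coefficients of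
    w^i + w^(7-i) in P(w x) P(w^6 x). With c = w + w^6 the other periods are c^2 - 2 and 1 - c -
    c^2, whence \<open>d0\<close>, \<open>d1\<close>, \<open>d2\<close>.\<close>
  define E1 E2 E3 where "E1 = - h * x ^ 9 + h ^ 2 * x ^ 7" and "E2 = - h * x ^ 8 + h ^ 2 * x ^ 5"
    and "E3 = - (h ^ 3 * x ^ 3) - h ^ 3 * x ^ 4"
  define d0 d1 d2 where "d0 = x ^ 10 + h ^ 2 * x ^ 8 + h ^ 2 * x ^ 6 + h ^ 4 - 2 * E2 + E3"
    and "d1 = E1 - E3" and "d2 = E2 - E3"
  have "P (w * x) * P (w ^ 6 * x) = d0 + d1 * (w + w ^ 6) + d2 * (w + w ^ 6) ^ 2"
    if w: "w ^ 7 = 1" "w \<noteq> 1" for w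
  proof -
    note s = root7_sum[OF w]
    have pw: "w ^ 8 = w" "w ^ 9 = w ^ 2" "w ^ 18 = w ^ 4" "w ^ 24 = w ^ 3" "w ^ 30 = w ^ 2"
      "w ^ 22 = w" "w ^ 23 = w ^ 2" "w ^ 27 = w ^ 6" "w ^ 28 = 1" "w ^ 29 = w" "w ^ 33 = w ^ 5"
      "w ^ 34 = w ^ 6" "w ^ 35 = 1" "w ^ 21 = 1"
      using w(1) by algebra+
    have "P (w * x) * P (w ^ 6 * x) = (x ^ 10 + h ^ 2 * x ^ 8 + h ^ 2 * x ^ 6 + h ^ 4)
      + E1 * (w + w ^ 6) + E2 * (w ^ 2 + w ^ 5) + E3 * (w ^ 3 + w ^ 4)"
      unfolding P_def E1_def E2_def E3_def power_mult_distrib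
      by (simp add: algebra_simps pw w(1) power2_eq_square[of h] power3_eq_cube[of h] power4_eq_xxxx[of h] flip: power_mult power_add)
    moreover have "w ^ 2 + w ^ 5 = (w + w ^ 6) ^ 2 - 2" using w(1) by algebra
    moreover have "w ^ 3 + w ^ 4 = 1 - (w + w ^ 6) - (w + w ^ 6) ^ 2" using w(1) s by algebra
    ultimately show ?thesis unfolding d0_def d1_def d2_def by (simp add: algebra_simps)
  qed
  from prod_root7[of "\<lambda>w. P (w * x)", OF this]
  have "(\<Prod>j<7. P (\<omega> ^ j * x)) = P x * (d0 ^ 3 - d0 ^ 2 * d1 + 5 * d0 ^ 2 * d2 - 2 * d0 * d1 ^ 2 - d0 * d1 * d2
      + 6 * d0 * d2 ^ 2 + d1 ^ 3 - d1 ^ 2 * d2 - 2 * d1 * d2 ^ 2 + d2 ^ 3)" by simp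
  also have "\<dots> = (x ^ 7) ^ 5 + (7 * h ^ 3 - 14 * h ^ 5 - 7 * h ^ 6 - h ^ 7) * (x ^ 7) ^ 4
    + (14 * h ^ 6 - 8 * h ^ 7) * (x ^ 7) ^ 3 + 14 * h ^ 10 * (x ^ 7) ^ 2 - 7 * h ^ 12 * x ^ 7 + h ^ 14"
    unfolding P_def d0_def d1_def d2_def E1_def E2_def E3_def by algebra
  finally show ?thesis .
qed

text \<open>The norm has degree 5 in x^7, so (1 - h)^5 clears the denominators of x^7 = h^3 / (1 -
  h). Only on this curve does it become a perfect square times a power of h.\<close>

lemma prod_quintic_root7_special:
  fixes h x :: complex
  assumes "x ^ 7 * (1 - h) = h ^ 3"
  shows "(1 - h) ^ 5 * (\<Prod>j<7. (\<omega> ^ j * x) ^ 5 - h * (\<omega> ^ j * x) ^ 4 - h * (\<omega> ^ j * x) ^ 3 + h ^ 2)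
    = (h ^ 3 - 8 * h ^ 2 + 5 * h + 1) ^ 2 * h ^ 14"
  unfolding prod_quintic_root7 using assms by algebra

end

lemma prod_qpoch_root7:
  assumes "\<omega> ^ 7 = 1" "\<omega> \<noteq> 1" "norm Q < 1"
  shows "(\<Prod>j<7. qpoch (\<omega> ^ j * z) Q) = qpoch (z ^ 7) (Q ^ 7)"
proof (rule LIMSEQ_unique)
  show "(\<lambda>n. \<Prod>j<7. \<Prod>k<n. 1 - \<omega> ^ j * z * Q ^ k) \<longlonglongrightarrow> (\<Prod>j<7. qpoch (\<omega> ^ j * z) Q)"
    by (intro tendsto_prod qpoch_LIMSEQ assms)
  have "(\<Prod>j<7. \<Prod>k<n. 1 - \<omega> ^ j * z * Q ^ k) = (\<Prod>k<n. 1 - z ^ 7 * (Q ^ 7) ^ k)" for n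
  proof (subst prod.swap, intro prod.cong refl)
    fix k
    show "(\<Prod>j<7. 1 - \<omega> ^ j * z * Q ^ k) = 1 - z ^ 7 * (Q ^ 7) ^ k"
      using prod_one_minus_root7[OF assms(1,2), of "z * Q ^ k"]
      by (simp add: power_mult_distrib mult.assoc mult.commute[of 7] flip: power_mult)
  qed
  moreover have "norm (Q ^ 7) < 1" using assms(3) by (simp add: norm_power power_less_one_iff)
  ultimately show "(\<lambda>n. \<Prod>j<7. \<Prod>k<n. 1 - \<omega> ^ j * z * Q ^ k) \<longlonglongrightarrow> qpoch (z ^ 7) (Q ^ 7)"
    by (simp add: qpoch_LIMSEQ)
qed

lemma euler_split7:
  assumes "norm q < 1"
  shows "qpoch q q = (\<Prod>r\<in>{1..6}. qpoch (q ^ r) (q ^ 7)) * qpoch (q ^ 7) (q ^ 7)"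
proof -
  have "qpoch q q = (\<Prod>r<7. qpoch (q ^ Suc r) (q ^ 7))"
    using qpoch_split[OF assms, of 7 q] by simp
  also have "\<dots> = (\<Prod>r\<in>{1..7}. qpoch (q ^ r) (q ^ 7))"
    by (rule prod.reindex_bij_witness[of _ "\<lambda>r. r - 1" Suc]) auto
  also have "{1..7} = insert 7 {1..6::nat}" by auto
  finally show ?thesis by simp
qed

text \<open>Factors with exponent divisible by 7 do not feel the root of unity and give F(q)^7. In
  the remaining classes the product over j replaces t^n by q^n and gives F(q)/F(q^7).\<close>

lemma prod_euler_root7:
  assumes "\<omega> ^ 7 = 1" "\<omega> \<noteq> 1" "norm t < 1"
  defines "q \<equiv> t ^ 7"
  shows "(\<Prod>j<7. qpoch (\<omega> ^ j * t) (\<omega> ^ j * t)) * qpoch (q ^ 7) (q ^ 7) = qpoch q q ^ 8"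
proof -
  have nw: "norm \<omega> = 1" using assms(1) by (metis norm_power norm_one norm_ge_zero power_eq_1_iff zero_neq_numeral)
  have q: "norm q < 1" using assms(3) by (simp add: q_def norm_power power_less_one_iff)
  have w: "(\<omega> ^ r) ^ 7 = 1" for r by (metis assms(1) mult.commute power_mult power_one)
  have w1: "\<omega> ^ r \<noteq> 1" if "r \<in> {1..6}" for r
  proof
    assume *: "\<omega> ^ r = 1"
    from that consider "r = 1" | "r = 2" | "r = 3" | "r = 4" | "r = 5" | "r = 6" by force
    \<comment> \<open>k is the inverse of r modulo 7; raising \<omega>^r = 1 to the power k would
      force \<omega> = 1.\<close>
    then have "\<exists>k m. r * k = 7 * m + 1"
      by cases (rule exI[of _ 1], force, rule exI[of _ 4], presburger, rule exI[of _ 5], presburger,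
        rule exI[of _ 2], presburger, rule exI[of _ 3], presburger, rule exI[of _ 6], presburger)
    then obtain k m where km: "r * k = 7 * m + 1" by blast
    have "\<omega> ^ (r * k) = \<omega> ^ (7 * m + 1)" by (simp only: km)
    then have "\<omega> = 1" using * assms(1) by (simp add: power_mult power_add)
    then show False using assms by simp
  qed
  have "qpoch (\<omega> ^ j * t) (\<omega> ^ j * t) = (\<Prod>r\<in>{1..6}. qpoch ((\<omega> ^ r) ^ j * t ^ r) q) * qpoch q q" for j
  proof -
    have "(\<omega> ^ j * t) ^ 7 = q" using w[of j] by (simp add: power_mult_distrib q_def)
    moreover have "norm (\<omega> ^ j * t) < 1" using assms(3) nw by (simp add: norm_mult norm_power)
    ultimately show ?thesis
      using euler_split7[of "\<omega> ^ j * t"] by (simp add: power_mult_distrib mult.commute flip: power_mult)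
  qed
  then have "(\<Prod>j<7. qpoch (\<omega> ^ j * t) (\<omega> ^ j * t))
      = (\<Prod>r\<in>{1..6}. \<Prod>j<7. qpoch ((\<omega> ^ r) ^ j * t ^ r) q) * qpoch q q ^ 7"
    by (simp add: prod.distrib) (subst prod.swap, simp)
  also have "(\<Prod>r\<in>{1..6}. \<Prod>j<7. qpoch ((\<omega> ^ r) ^ j * t ^ r) q) = (\<Prod>r\<in>{1..6}. qpoch (q ^ r) (q ^ 7))"
    by (intro prod.cong refl, subst prod_qpoch_root7[OF w w1 q])
       (auto simp: q_def mult.commute simp flip: power_mult)
  finally show ?thesis using euler_split7[OF q] by (simp add: eval_nat_numeral mult_ac)
qed

text \<open>Unlike \<open>jac (q ^ k) (q ^ 7)\<close> this uses q^(7-k) instead of q^7 / q^k, so it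
  is holomorphic at q = 0 with the correct value 1, where the sign and the normalisation are read
  off.\<close>

definition theta7 :: "nat \<Rightarrow> complex \<Rightarrow> complex" where
  "theta7 k q = qpoch (q ^ k) (q ^ 7) * qpoch (q ^ (7 - k)) (q ^ 7) * qpoch (q ^ 7) (q ^ 7)"

lemma theta7_eq_jac: "q \<noteq> 0 \<Longrightarrow> k \<le> 7 \<Longrightarrow> theta7 k q = jac (q ^ k) (q ^ 7)"
  by (simp add: theta7_def jac_def power_diff)

lemma norm_power_lt_1: "norm q < 1 \<Longrightarrow> k > 0 \<Longrightarrow> norm (q ^ k) < 1" for q :: complex
  by (simp add: norm_power power_less_one_iff)

lemma theta7_nonzero: "norm q < 1 \<Longrightarrow> 0 < k \<Longrightarrow> k < 7 \<Longrightarrow> theta7 k q \<noteq> 0"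
  by (simp add: theta7_def qpoch_nonzero norm_power_lt_1)

text \<open>Together the three thetas contain every nonzero residue class modulo 7 once and the
  class 0 three times.\<close>

lemma theta7_prod:
  assumes "norm q < 1"
  shows "theta7 1 q * theta7 2 q * theta7 3 q = qpoch q q * qpoch (q ^ 7) (q ^ 7) ^ 2"
proof -
  have "{1..6::nat} = {1,2,3,4,5,6}" by auto
  then show ?thesis
    unfolding euler_split7[OF assms] by (simp add: theta7_def power2_eq_square mult_ac)
qed

lemma qpoch_0_0 [simp]: "qpoch 0 Q = 1"
  by (simp add: qpoch_def)

lemma theta7_0: "0 < k \<Longrightarrow> k < 7 \<Longrightarrow> theta7 k 0 = 1"
  by (simp add: theta7_def zero_power)

lemma klein_quartic_theta7:
  assumes "norm q < 1" "q \<noteq> 0"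
  shows "theta7 3 q ^ 3 * theta7 1 q - theta7 2 q ^ 3 * theta7 3 q + q * theta7 1 q ^ 3 * theta7 2 q = 0"
  using klein_quartic_jac[OF assms] assms by (simp add: theta7_eq_jac)

text \<open>Each of the four terms is s^2 times a monomial in y and h. The conjugation of s is
  thereby moved entirely into y.\<close>

lemma quintic_factorisation:
  fixes T1 T2 T3 s :: complex
  assumes "T1 \<noteq> 0" "T2 \<noteq> 0" "T3 \<noteq> 0" "s \<noteq> 0"
  defines "h \<equiv> T3 ^ 2 * T1 / T2 ^ 3" and "y \<equiv> T3 / (T2 * s)"
  shows "T2 / T1 - s * (T3 / T2) - s ^ 2 + s ^ 5 * (T1 / T3) = s ^ 2 * (y ^ 5 - h * y ^ 4 - h * y ^ 3 + h ^ 2) / (h * y ^ 3)"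
proof -
  have nz: "h \<noteq> 0" "y \<noteq> 0" using assms by simp_all
  have "s ^ 2 * (y ^ 5 - h * y ^ 4 - h * y ^ 3 + h ^ 2) / (h * y ^ 3) = s ^ 2 * (y ^ 2 / h) - s * (s * y) - s ^ 2 + s ^ 2 * (h / y ^ 3)"
    using nz by (simp add: field_simps eval_nat_numeral)
  moreover have "s ^ 2 * (y ^ 2 / h) = T2 / T1" "s * y = T3 / T2" "s ^ 2 * (h / y ^ 3) = s ^ 5 * (T1 / T3)"
    using assms(1-4) by (simp_all add: h_def y_def field_simps eval_nat_numeral)
  ultimately show ?thesis by simp
qed

text \<open>A Hauptmodul for $\Gamma_1(7)$ as a function of $q$; it is 1 at $q = 0$.\<close>

definition hmod :: "complex \<Rightarrow> complex" where
  "hmod q = theta7 3 q ^ 2 * theta7 1 q / theta7 2 q ^ 3"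

text \<open>The Klein quartic divided by T_2^3 T_3. It shows in particular that
  \<open>hmod q\<close> differs from 1 away from q = 0.\<close>

lemma one_minus_hmod:
  assumes "norm q < 1" "q \<noteq> 0"
  shows "1 - hmod q = q * theta7 1 q ^ 3 / (theta7 3 q * theta7 2 q ^ 2)"
proof -
  define T1 T2 T3 where "T1 = theta7 1 q" and "T2 = theta7 2 q" and "T3 = theta7 3 q"
  have nz: "T1 \<noteq> 0" "T2 \<noteq> 0" "T3 \<noteq> 0"
    using theta7_nonzero[OF assms(1)] by (simp_all add: T1_def T2_def T3_def)
  have K: "T3 ^ 3 * T1 - T2 ^ 3 * T3 + q * T1 ^ 3 * T2 = 0"
    using klein_quartic_theta7[OF assms] by (simp add: T1_def T2_def T3_def)
  have "T2 ^ 3 * T3 * (1 - T3 ^ 2 * T1 / T2 ^ 3) = T2 ^ 3 * T3 * (q * T1 ^ 3 / (T3 * T2 ^ 2))"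
    using nz K by (simp add: field_simps) algebra
  then have "1 - T3 ^ 2 * T1 / T2 ^ 3 = q * T1 ^ 3 / (T3 * T2 ^ 2)"
    by (simp only: mult_cancel_left) (use nz in simp)
  then show ?thesis by (simp add: hmod_def T1_def T2_def T3_def)
qed

lemma euler_quotient_power8:
  assumes q: "norm q < 1" "q \<noteq> 0"
  defines "h \<equiv> hmod q"
  shows "(qpoch q q / qpoch (q ^ 7) (q ^ 7)) ^ 8 = (q * (h ^ 3 - 8 * h ^ 2 + 5 * h + 1) / (h * (1 - h))) ^ 2"
proof -
  define t where "t = exp (Ln q / 7)"
  have t7: "t ^ 7 = q" using q by (simp add: t_def flip: exp_of_nat_mult)
  have "norm t ^ 7 < 1" using q(1) by (simp add: t7 flip: norm_power)
  then have t: "norm t < 1" "t \<noteq> 0"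
    using power_less_one_iff[of "norm t" 7] by (auto simp: t_def)
  define \<zeta> where "\<zeta> = exp (2 * of_real pi * \<i> / 7)"
  have \<zeta>: "\<zeta> ^ 7 = 1" "\<zeta> \<noteq> 1"
    using complex_root_unity[of 7 1] complex_root_unity_eq_1[of 7 1] by (auto simp: \<zeta>_def)
  \<comment> \<open>The inverse of \<zeta>: replacing t by \<zeta>^j t multiplies x, which has t in
    its denominator, by \<omega>^j.\<close>
  define \<omega> where "\<omega> = \<zeta> ^ 6"
  have \<omega>\<zeta>: "\<omega> * \<zeta> = 1" using \<zeta>(1) by (simp add: \<omega>_def flip: power_Suc2)
  have \<omega>: "\<omega> ^ 7 = 1" "\<omega> \<noteq> 1"
    using \<zeta> \<omega>\<zeta> by (metis mult.commute \<omega>_def power_mult power_one, metis mult_1)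
  have w0: "\<zeta> \<noteq> 0" "\<omega> \<noteq> 0" using \<omega>\<zeta> by auto
  define T1 T2 T3 G where "T1 = theta7 1 q" and "T2 = theta7 2 q" and "T3 = theta7 3 q" and "G = qpoch (q ^ 7) (q ^ 7)"
  have nz: "T1 \<noteq> 0" "T2 \<noteq> 0" "T3 \<noteq> 0"
    using theta7_nonzero[OF q(1)] by (simp_all add: T1_def T2_def T3_def)
  have G: "G \<noteq> 0" using q by (simp add: G_def qpoch_nonzero norm_power_lt_1)
  have h: "h = T3 ^ 2 * T1 / T2 ^ 3" by (simp add: h_def hmod_def T1_def T2_def T3_def)
  have h1: "1 - h = q * T1 ^ 3 / (T3 * T2 ^ 2)"
    using one_minus_hmod[OF q] by (simp add: h_def T1_def T2_def T3_def)
  have hnz: "h \<noteq> 0" "1 - h \<noteq> 0" unfolding h1 using nz q by (simp_all add: h)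
  define x where "x = T3 / (T2 * t)"
  have x0: "x \<noteq> 0" using nz t by (simp add: x_def)
  have "x ^ 7 = T3 ^ 7 / (T2 ^ 7 * q)" by (simp add: x_def power_divide power_mult_distrib t7)
  then have x7: "x ^ 7 * (1 - h) = h ^ 3"
    unfolding h1 unfolding h using nz q by (simp add: field_simps eval_nat_numeral)
  define P where "P = (\<lambda>y. y ^ 5 - h * y ^ 4 - h * y ^ 3 + h ^ 2)"
  have fac: "qpoch (\<zeta> ^ j * t) (\<zeta> ^ j * t) = G * ((\<zeta> ^ j * t) ^ 2 * P (\<omega> ^ j * x) / (h * (\<omega> ^ j * x) ^ 3))" for j
  proof -
    let ?s = "\<zeta> ^ j * t"
    have s7: "?s ^ 7 = q"
      by (simp add: power_mult_distrib t7) (metis \<zeta>(1) mult.commute power_mult power_one)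
    have "norm ?s ^ 7 < 1" using q(1) by (simp flip: s7 norm_power)
    then have s: "norm ?s < 1" "?s \<noteq> 0" using power_less_one_iff[of "norm ?s" 7] w0 t by auto
    have "\<omega> ^ j * \<zeta> ^ j = 1" using \<omega>\<zeta> by (metis power_mult_distrib power_one)
    then have y: "\<omega> ^ j * x = T3 / (T2 * ?s)"
      using w0 t nz by (simp add: x_def field_simps)
    have "qpoch ?s ?s = G * (T2 / T1 - ?s * (T3 / T2) - ?s ^ 2 + ?s ^ 5 * (T1 / T3))"
      using euler_dissection[OF s] nz unfolding s7 T1_def T2_def T3_def G_def
      using q by (simp add: theta7_eq_jac)
    then show ?thesis
      unfolding quintic_factorisation[OF nz s(2)] y P_def h .
  qed
  have prod_power: "(\<Prod>j<7. \<alpha> ^ j * z) = z ^ 7" if "\<alpha> ^ 7 = 1" for \<alpha> z :: complex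
  proof -
    have "(\<Prod>j<7. \<alpha> ^ j * z) = (\<alpha> ^ 7) ^ 3 * z ^ 7"
      by (simp add: eval_nat_numeral lessThan_Suc mult_ac)
    then show ?thesis using that by simp
  qed
  have "(\<Prod>j<7. qpoch (\<zeta> ^ j * t) (\<zeta> ^ j * t))
      = G ^ 7 * ((\<Prod>j<7. \<zeta> ^ j * t) ^ 2 * (\<Prod>j<7. P (\<omega> ^ j * x)) / (h ^ 7 * (\<Prod>j<7. \<omega> ^ j * x) ^ 3))"
  proof -
    have "(\<Prod>j<7. G * (a j ^ 2 * b j / (h * c j ^ 3)))
        = G ^ 7 * ((\<Prod>j<7. a j) ^ 2 * (\<Prod>j<7. b j) / (h ^ 7 * (\<Prod>j<7. c j) ^ 3))" for a b c :: "nat \<Rightarrow> complex"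
      by (simp add: prod.distrib prod_dividef prod_power_distrib)
    then show ?thesis unfolding fac .
  qed
  then have "qpoch q q ^ 8 = G ^ 8 * (q ^ 2 * (\<Prod>j<7. P (\<omega> ^ j * x)) / (h ^ 7 * (x ^ 7) ^ 3))"
    using prod_euler_root7[OF \<zeta> t(1)] unfolding prod_power[OF \<zeta>(1)] prod_power[OF \<omega>(1)] t7
    by (simp add: G_def eval_nat_numeral mult_ac)
  moreover have "(1 - h) ^ 5 * (\<Prod>j<7. P (\<omega> ^ j * x)) = (h ^ 3 - 8 * h ^ 2 + 5 * h + 1) ^ 2 * h ^ 14"
    unfolding P_def by (rule prod_quintic_root7_special[OF \<omega> x7])
  then have "(\<Prod>j<7. P (\<omega> ^ j * x)) = (h ^ 3 - 8 * h ^ 2 + 5 * h + 1) ^ 2 * h ^ 14 / (1 - h) ^ 5"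
    using hnz by (simp add: field_simps)
  moreover have "x ^ 7 = h ^ 3 / (1 - h)" using x7 hnz by (simp add: field_simps)
  moreover have "q ^ 2 * (D ^ 2 * h ^ 14 / k ^ 5) / (h ^ 7 * (h ^ 3 / k) ^ 3) = (q * D / (h * k)) ^ 2"
    if "k \<noteq> 0" for D k
  proof -
    have "h ^ 14 = h ^ 2 * (h ^ 7 * (h ^ 3) ^ 3) / h ^ 4" using hnz by (simp add: field_simps flip: power_add power_mult)
    then show ?thesis using that hnz by (simp add: field_simps eval_nat_numeral)
  qed
  ultimately have "qpoch q q ^ 8 = G ^ 8 * (q * (h ^ 3 - 8 * h ^ 2 + 5 * h + 1) / (h * (1 - h))) ^ 2"
    using hnz(2) by metis
  then show ?thesis using G by (simp add: G_def power_divide field_simps)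
qed

subsection \<open>The Hauptmodul of level 7 and the cube root\<close>

text \<open>This is q X for the X of the overview, with the zero of 1 - h at q = 0 cancelled against
  q through \<open>one_minus_hmod\<close>, so that it is holomorphic at 0.\<close>

definition haupt :: "complex \<Rightarrow> complex" where
  "haupt q = - ((hmod q ^ 3 - 8 * hmod q ^ 2 + 5 * hmod q + 1) * theta7 2 q ^ 5 / (theta7 3 q * theta7 1 q ^ 4))"

lemma haupt_eq:
  assumes "norm q < 1" "q \<noteq> 0"
  shows "haupt q = - (q * (hmod q ^ 3 - 8 * hmod q ^ 2 + 5 * hmod q + 1) / (hmod q * (1 - hmod q)))"
proof -
  have "h * (q * T1 ^ 3 / (T3 * T2 ^ 2)) = q * T3 * T1 ^ 4 / T2 ^ 5"
    if "T2 \<noteq> 0" "T3 \<noteq> 0" "h = T3 ^ 2 * T1 / T2 ^ 3" for h T1 T2 T3 :: complex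
    using that by (simp add: field_simps eval_nat_numeral)
  then have "hmod q * (1 - hmod q) = q * theta7 3 q * theta7 1 q ^ 4 / theta7 2 q ^ 5"
    unfolding one_minus_hmod[OF assms] by (simp add: hmod_def theta7_nonzero assms(1))
  then show ?thesis using assms(2) by (simp add: haupt_def)
qed

lemma holomorphic_theta7: "theta7 k holomorphic_on ball 0 1"
proof -
  have "norm (q ^ 7) < 1" if "q \<in> ball 0 1" for q :: complex
    using that by (intro norm_power_lt_1) auto
  then show ?thesis
    unfolding theta7_def[abs_def] by (intro holomorphic_intros holomorphic_qpoch) auto
qed

lemma holomorphic_euler: "(\<lambda>q. qpoch q q) holomorphic_on ball 0 1"
  "(\<lambda>q. qpoch (q ^ 7) (q ^ 7)) holomorphic_on ball 0 1"
  by (intro holomorphic_intros holomorphic_qpoch; auto intro!: norm_power_lt_1 simp del: norm_power)+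

text \<open>The norm argument only gives the square of this identity; the sign is constant on the
  disc by continuity and is fixed at $q = 0$.\<close>

lemma euler_quotient_power4:
  assumes "norm q < 1"
  shows "(qpoch q q / qpoch (q ^ 7) (q ^ 7)) ^ 4 = haupt q"
proof -
  define E where "E q = (qpoch q q / qpoch (q ^ 7) (q ^ 7)) ^ 4" for q
  define B where "B = (ball 0 1 :: complex set)"
  have nz: "qpoch q q \<noteq> 0" "qpoch (q ^ 7) (q ^ 7) \<noteq> 0" if "q \<in> B" for q
    using that qpoch_nonzero[of q q] qpoch_nonzero[of "q ^ 7" "q ^ 7"] norm_power_lt_1[of q 7]
    by (auto simp: B_def)
  have E0: "E q \<noteq> 0" if "q \<in> B" for q using nz[OF that] by (simp add: E_def)
  have at0: "E 0 = 1" "haupt 0 = 1"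
    by (simp_all add: E_def haupt_def hmod_def theta7_0)
  have sq: "E q ^ 2 = haupt q ^ 2" if "q \<in> B" for q
  proof (cases "q = 0")
    case False
    have "E q ^ 2 = (qpoch q q / qpoch (q ^ 7) (q ^ 7)) ^ 8" by (simp add: E_def flip: power_mult)
    also have "\<dots> = haupt q ^ 2"
      using euler_quotient_power8[of q] haupt_eq[of q] False that by (simp add: B_def)
    finally show ?thesis .
  qed (simp add: at0)
  have th: "theta7 k q \<noteq> 0" if "q \<in> B" "0 < k" "k < 7" for k q
    using that by (intro theta7_nonzero) (auto simp: B_def)
  have "(\<lambda>q. haupt q / E q) holomorphic_on B"
    unfolding haupt_def hmod_def E_def B_def
    by (intro holomorphic_intros holomorphic_theta7 holomorphic_euler) (use th nz in \<open>auto simp: B_def\<close>)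
  then have "continuous_on B (\<lambda>q. haupt q / E q)"
    by (rule holomorphic_on_imp_continuous_on)
  moreover have "(\<lambda>q. haupt q / E q) ` B \<subseteq> {1, -1}"
  proof
    fix z assume "z \<in> (\<lambda>q. haupt q / E q) ` B"
    then obtain q where q: "q \<in> B" "z = haupt q / E q" by blast
    have "z ^ 2 = 1" using E0[OF q(1)] by (simp add: q(2) power_divide flip: sq[OF q(1)])
    then show "z \<in> {1, -1}" by (simp add: power2_eq_1_iff)
  qed
  then have "finite ((\<lambda>q. haupt q / E q) ` B)"
    by (rule finite_subset) auto
  ultimately have "(\<lambda>q. haupt q / E q) constant_on B"
    by (intro continuous_finite_range_constant) (auto simp: B_def)
  then have "haupt q / E q = haupt 0 / E 0"
    unfolding constant_on_def using assms by (force simp: B_def)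
  then show ?thesis using at0 E0[of q] assms by (simp add: B_def E_def field_simps)
qed

text \<open>The function $q^{1/3} j_7^*(\tau)^{1/3}$ in terms of $q$.\<close>

definition j7star_root :: "complex \<Rightarrow> complex" where
  "j7star_root q = (theta7 3 q / theta7 1 q ^ 2 + q * (theta7 2 q / theta7 3 q ^ 2 - theta7 1 q / theta7 2 q ^ 2))
     * qpoch (q ^ 7) (q ^ 7) ^ 2 / qpoch q q"

text \<open>The theta bracket is T_3/T_1^2 times (h^2 - h + 1)/h, so its cube carries the numerator
  of X^2 + 13X + 49. The remaining theta monomial is supplied by T_1 T_2 T_3 = F G^2.\<close>

lemma j7star_root_power3:
  assumes q: "norm q < 1" "q \<noteq> 0"
  defines "X \<equiv> (qpoch q q / qpoch (q ^ 7) (q ^ 7)) ^ 4 / q"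
  shows "j7star_root q ^ 3 = q * (X + 13 + 49 / X)"
proof -
  define T1 T2 T3 F G where "T1 = theta7 1 q" and "T2 = theta7 2 q" and "T3 = theta7 3 q"
    and "F = qpoch q q" and "G = qpoch (q ^ 7) (q ^ 7)"
  note T = T1_def T2_def T3_def
  have nz: "T1 \<noteq> 0" "T2 \<noteq> 0" "T3 \<noteq> 0"
    using theta7_nonzero[OF q(1)] by (simp_all add: T)
  have FG: "F \<noteq> 0" "G \<noteq> 0" using q by (simp_all add: F_def G_def qpoch_nonzero norm_power_lt_1)
  have TFG: "T1 * T2 * T3 = F * G ^ 2" using theta7_prod[OF q(1)] by (simp add: T F_def G_def)
  define h where "h = hmod q"
  define k where "k = 1 - h"
  have h: "h = T3 ^ 2 * T1 / T2 ^ 3" by (simp add: h_def hmod_def T)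
  have k: "k = q * T1 ^ 3 / (T3 * T2 ^ 2)" using one_minus_hmod[OF q] by (simp add: h_def k_def T)
  have hk: "h \<noteq> 0" "k \<noteq> 0" using nz q by (simp_all add: h) (simp add: k)
  define S where "S = T3 / T1 ^ 2 + q * (T2 / T3 ^ 2 - T1 / T2 ^ 2)"
  have "S = T3 / T1 ^ 2 * (1 + k / h - k)"
    unfolding h k S_def using nz by (simp add: field_simps eval_nat_numeral)
  also have "1 + k / h - k = (h ^ 2 - h + 1) / h"
    using hk by (simp add: k_def field_simps power2_eq_square)
  finally have S: "S = T3 / T1 ^ 2 * ((h ^ 2 - h + 1) / h)" .
  have qT: "T3 ^ 4 * T2 / T1 ^ 5 / h ^ 3 = q ^ 2 / (h * k) ^ 2"
    unfolding h k using nz q by (simp add: field_simps eval_nat_numeral)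
  have "S ^ 3 * (T1 * T2 * T3) = T3 ^ 4 * T2 / T1 ^ 5 / h ^ 3 * (h ^ 2 - h + 1) ^ 3"
    unfolding S using nz hk(1) by (simp add: power_divide power_mult_distrib) (simp add: field_simps eval_nat_numeral)
  then have S3: "S ^ 3 * (T1 * T2 * T3) = q ^ 2 * ((h ^ 2 - h + 1) ^ 3 / (h * k) ^ 2)"
    unfolding qT by simp
  have X: "X = - ((h ^ 3 - 8 * h ^ 2 + 5 * h + 1) / (h * k))"
    using euler_quotient_power4[OF q(1)] haupt_eq[OF q] q(2) by (simp add: X_def h_def k_def)
  have "X ^ 2 + 13 * X + 49 = (h ^ 2 - h + 1) ^ 3 / (h * k) ^ 2"
  proof -
    have "X * (h * k) = - (h ^ 3 - 8 * h ^ 2 + 5 * h + 1)" unfolding X using hk by simp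
    \<comment> \<open>With D = h^3 - 8h^2 + 5h + 1 this is D^2 - 13 D hk + 49 (hk)^2 = (h^2 - h +
      1)^3, a polynomial identity in h once k = 1 - h.\<close>
    then have "(X ^ 2 + 13 * X + 49) * (h * k) ^ 2 = (h ^ 2 - h + 1) ^ 3"
      unfolding k_def by algebra
    then show ?thesis using hk by (simp add: field_simps)
  qed
  then have S3': "S ^ 3 * (F * G ^ 2) = q ^ 2 * (X ^ 2 + 13 * X + 49)"
    using S3 TFG by simp
  have X0: "X \<noteq> 0" using FG q by (simp add: X_def F_def G_def)
  have XFG: "X * q * G ^ 4 = F ^ 4" using FG q by (simp add: X_def F_def G_def power_divide)
  have "j7star_root q = S * G ^ 2 / F" by (simp add: j7star_root_def S_def T F_def G_def)
  then have "j7star_root q ^ 3 * (X * q) = S ^ 3 * G ^ 6 / F ^ 3 * (X * q)"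
    by (simp add: power_divide power_mult_distrib flip: power_mult)
  also have "\<dots> = S ^ 3 * G ^ 2 / F ^ 3 * (X * q * G ^ 4)"
    by (simp add: field_simps flip: power_add)
  also have "\<dots> = S ^ 3 * (F * G ^ 2)"
    unfolding XFG using FG by (simp add: field_simps eval_nat_numeral)
  finally have "j7star_root q ^ 3 * (X * q) = q ^ 2 * (X ^ 2 + 13 * X + 49)" using S3' by simp
  then have "q * (j7star_root q ^ 3 * X) = q * (q * (X ^ 2 + 13 * X + 49))"
    by (simp only: power2_eq_square mult_ac)
  then have "j7star_root q ^ 3 = q * (X ^ 2 + 13 * X + 49) / X"
    unfolding mult_cancel_left using X0 q(2) by (simp add: eq_divide_eq)
  also have "\<dots> = q * (X + 13 + 49 / X)"
    using X0 by (simp add: field_simps power2_eq_square)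
  finally show ?thesis .
qed

lemma holomorphic_j7star_root: "j7star_root holomorphic_on ball 0 1"
  unfolding j7star_root_def
  by (intro holomorphic_intros holomorphic_theta7 holomorphic_euler)
     (auto simp: theta7_nonzero qpoch_nonzero)

lemma j7star_root_0: "j7star_root 0 = 1"
  by (simp add: j7star_root_def theta7_0)

text \<open>Differentiability at 0 bounds the difference quotient near 0; this is the 1 + O(q) of
  the normalisation.\<close>

lemma j7star_root_near_0: "\<exists>\<delta> C. \<delta> > 0 \<and> (\<forall>q. norm q < \<delta> \<longrightarrow> norm (j7star_root q - 1) \<le> C * norm q)"
proof -
  obtain D where "(j7star_root has_field_derivative D) (at 0)"
    using holomorphic_j7star_root unfolding holomorphic_on_open[OF open_ball] by force
  then have "(\<lambda>q. (j7star_root q - 1) / q) \<midarrow>0\<rightarrow> D"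
    by (simp add: has_field_derivative_iff j7star_root_0)
  then have "\<forall>\<^sub>F q in at 0. norm ((j7star_root q - 1) / q) < norm D + 1"
    by (intro order_tendstoD(2)[OF tendsto_norm]) auto
  then obtain \<delta> where \<delta>: "\<delta> > 0" "\<And>q. q \<noteq> 0 \<Longrightarrow> norm q < \<delta> \<Longrightarrow> norm ((j7star_root q - 1) / q) < norm D + 1"
    by (auto simp: eventually_at)
  have "norm (j7star_root q - 1) \<le> (norm D + 1) * norm q" if "norm q < \<delta>" for q
    using \<delta>(2)[of q] that by (cases "q = 0") (auto simp: j7star_root_0 norm_divide field_simps)
  then show ?thesis using \<delta>(1) by blast
qed

section \<open>Passage from q to \<tau> and conclusion\<close>

lemma norm_qn: "norm (qn \<tau>) = exp (- 2 * pi * Im \<tau>)"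
  by (simp add: qn_def)

lemma prodinf_theta7:
  assumes "norm q < 1" "0 < k" "k < 7"
  shows "(\<Prod>n. (1 - q ^ (7 * n + k)) * (1 - q ^ (7 * n + (7 - k))) * (1 - q ^ (7 * n + 7))) = theta7 k q"
proof -
  have "(\<lambda>n. (1 - q ^ k * (q ^ 7) ^ n) * (1 - q ^ (7 - k) * (q ^ 7) ^ n) * (1 - q ^ 7 * (q ^ 7) ^ n)) has_prod theta7 k q"
    unfolding theta7_def by (intro has_prod_mult qpoch_has_prod norm_power_lt_1 assms) auto
  from has_prod_unique[OF this] show ?thesis
    by (simp add: mult.commute add.commute flip: power_mult power_add)
qed

lemma qpow_power: "qpow \<alpha> \<tau> ^ n = qpow (of_nat n * \<alpha>) \<tau>"
  by (simp add: qpow_def mult_ac flip: exp_of_nat_mult)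

text \<open>168 is the least common multiple of 56, 24 and 3, so every fractional power of q
  involved is an integer power of the one number \<open>s\<close>.\<close>

lemma modular_functions_eq:
  assumes "\<tau> \<in> upper_half_plane"
  defines "q \<equiv> qn \<tau>" and "s \<equiv> qpow (1/168) \<tau>"
  shows "norm q < 1" "q = s ^ 168" "s \<noteq> 0" "qpow (1/3) \<tau> = s ^ 56"
    "u_fun \<tau> = s ^ 3 * theta7 3 q" "v_fun \<tau> = s ^ 27 * theta7 2 q" "w_fun \<tau> = s ^ 75 * theta7 1 q"
    "eta \<tau> = s ^ 7 * qpoch q q" "eta (7 * \<tau>) = s ^ 49 * qpoch (q ^ 7) (q ^ 7)"
proof -
  show q: "norm q < 1" using assms(1) by (simp add: q_def norm_qn upper_half_plane_def)
  show "q = s ^ 168" "s \<noteq> 0" "qpow (1/3) \<tau> = s ^ 56"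
    by (simp_all add: s_def qpow_power) (simp_all add: q_def qn_def qpow_def)
  show "u_fun \<tau> = s ^ 3 * theta7 3 q" "v_fun \<tau> = s ^ 27 * theta7 2 q" "w_fun \<tau> = s ^ 75 * theta7 1 q"
    using prodinf_theta7[OF q, of 3] prodinf_theta7[OF q, of 2] prodinf_theta7[OF q, of 1]
    by (simp_all add: u_fun_def v_fun_def w_fun_def s_def qpow_power flip: q_def)
  show "eta \<tau> = s ^ 7 * qpoch q q"
    by (simp add: eta_def qpoch_def s_def qpow_power flip: q_def)
  have "qn (7 * \<tau>) = q ^ 7" by (simp add: q_def qn_def mult_ac flip: exp_of_nat_mult)
  moreover have "qpow (1/24) (7 * \<tau>) = s ^ 49" by (simp add: s_def qpow_power) (simp add: qpow_def mult_ac)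
  ultimately show "eta (7 * \<tau>) = s ^ 49 * qpoch (q ^ 7) (q ^ 7)"
    by (simp add: eta_def qpoch_def)
qed

theorem theorem1:
  shows "(\<forall>\<tau>\<in>upper_half_plane.
           (u_fun \<tau>)^2 / v_fun \<tau> - (v_fun \<tau>)^2 / w_fun \<tau> + (w_fun \<tau>)^2 / u_fun \<tau> = 0)
       \<and> (\<exists>c :: complex \<Rightarrow> complex.
           c meromorphic_on upper_half_plane
         \<and> (\<forall>\<tau>\<in>upper_half_plane. (c \<tau>) ^ 3 = j7star \<tau>)
         \<and> (\<exists>C M. \<forall>\<tau>\<in>upper_half_plane. Im \<tau> \<ge> M \<longrightarrow>
               norm (c \<tau> * qpow (1/3) \<tau> - 1) \<le> C * norm (qn \<tau>))
         \<and> (\<forall>\<tau>\<in>upper_half_plane.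
              v_fun \<tau> / (u_fun \<tau>)^2 - w_fun \<tau> / (v_fun \<tau>)^2 + u_fun \<tau> / (w_fun \<tau>)^2
              = eta \<tau> / (eta (7*\<tau>))^2 * c \<tau>))"
\<comment> \<open>The witness has q^(-1/3) as an explicit factor; the other factor is single-valued
  in q.\<close>
proof (intro conjI ballI exI[of _ "\<lambda>\<tau>. j7star_root (qn \<tau>) / qpow (1/3) \<tau>"])
  fix \<tau> assume \<tau>: "\<tau> \<in> upper_half_plane"
  define q s where "q = qn \<tau>" and "s = qpow (1/168) \<tau>"
  note eqs = modular_functions_eq[OF \<tau>, folded q_def s_def]
  define T1 T2 T3 F G where "T1 = theta7 1 q" and "T2 = theta7 2 q" and "T3 = theta7 3 q"
    and "F = qpoch q q" and "G = qpoch (q ^ 7) (q ^ 7)"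
  note T = T1_def T2_def T3_def F_def G_def
  have q: "norm q < 1" "q \<noteq> 0" using eqs(1-3) by auto
  have nz: "T1 \<noteq> 0" "T2 \<noteq> 0" "T3 \<noteq> 0" "F \<noteq> 0" "G \<noteq> 0" "s \<noteq> 0"
    using theta7_nonzero[OF q(1)] q eqs(3) by (simp_all add: T qpoch_nonzero norm_power_lt_1)
  have uvw: "u_fun \<tau> = s ^ 3 * T3" "v_fun \<tau> = s ^ 27 * T2" "w_fun \<tau> = s ^ 75 * T1"
    "eta \<tau> = s ^ 7 * F" "eta (7 * \<tau>) = s ^ 49 * G" using eqs by (simp_all add: T)
  have "u_fun \<tau> ^ 2 / v_fun \<tau> - v_fun \<tau> ^ 2 / w_fun \<tau> + w_fun \<tau> ^ 2 / u_fun \<tau>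
     = (T3 ^ 3 * T1 - T2 ^ 3 * T3 + s ^ 168 * T1 ^ 3 * T2) / (s ^ 21 * (T1 * T2 * T3))"
    unfolding uvw power_mult_distrib power_mult[symmetric] using nz
    by (simp add: field_simps power2_eq_square[of T1] power2_eq_square[of T2] power2_eq_square[of T3]
        power3_eq_cube[of T1] power3_eq_cube[of T2] power3_eq_cube[of T3] flip: power_add)
  also have "\<dots> = 0"
    using klein_quartic_theta7[OF q] by (simp add: T flip: eqs(2))
  finally show "u_fun \<tau> ^ 2 / v_fun \<tau> - v_fun \<tau> ^ 2 / w_fun \<tau> + w_fun \<tau> ^ 2 / u_fun \<tau> = 0" .
  have cub: "j7star_root (qn \<tau>) / qpow (1/3) \<tau> = (T3 / T1 ^ 2 + s ^ 168 * (T2 / T3 ^ 2 - T1 / T2 ^ 2)) * G ^ 2 / F / s ^ 56"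
    using eqs(4) by (simp add: j7star_root_def T flip: q_def eqs(2))
  show "v_fun \<tau> / (u_fun \<tau>)^2 - w_fun \<tau> / (v_fun \<tau>)^2 + u_fun \<tau> / (w_fun \<tau>)^2
      = eta \<tau> / (eta (7*\<tau>))^2 * (j7star_root (qn \<tau>) / qpow (1/3) \<tau>)"
    \<comment> \<open>Both sides carry the same theta bracket by the choice of
      \<open>j7star_root\<close>; only powers of \<open>s\<close> remain to be compared.\<close>
    unfolding cub uvw power_mult_distrib power_mult[symmetric] using nz
    by (simp add: field_simps flip: power_add)
  have "(eta \<tau> / eta (7 * \<tau>)) ^ 4 = (F / G) ^ 4 / q"
    unfolding uvw eqs(2) using nz by (simp add: power_divide power_mult_distrib field_simps flip: power_mult power_add)
  moreover from this have "(eta (7 * \<tau>) / eta \<tau>) ^ 4 = 1 / ((F / G) ^ 4 / q)"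
    by (metis inverse_divide inverse_eq_divide power_inverse)
  moreover have "(j7star_root (qn \<tau>) / qpow (1/3) \<tau>) ^ 3 = j7star_root q ^ 3 / q"
    unfolding eqs(2,4) q_def[symmetric] by (simp add: power_divide flip: power_mult)
  ultimately show "(j7star_root (qn \<tau>) / qpow (1/3) \<tau>) ^ 3 = j7star \<tau>"
    using j7star_root_power3[OF q] q(2) by (simp add: j7star_def T)
next
  have "open upper_half_plane"
    by (simp add: upper_half_plane_def open_halfspace_Im_gt)
  moreover have "(\<lambda>\<tau>. j7star_root (qn \<tau>) / qpow (1/3) \<tau>) holomorphic_on upper_half_plane"
  proof -
    have "(j7star_root \<circ> qn) holomorphic_on upper_half_plane"
    proof (rule holomorphic_on_compose_gen[OF _ holomorphic_j7star_root])
      show "qn holomorphic_on upper_half_plane"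
        unfolding qn_def[abs_def] by (intro holomorphic_intros)
      show "qn ` upper_half_plane \<subseteq> ball 0 1" using modular_functions_eq(1) by auto
    qed
    then show ?thesis
      unfolding qpow_def o_def by (intro holomorphic_intros) auto
  qed
  ultimately show "(\<lambda>\<tau>. j7star_root (qn \<tau>) / qpow (1/3) \<tau>) meromorphic_on upper_half_plane"
    by (simp add: analytic_on_imp_meromorphic_on analytic_on_open)
  obtain \<delta> C where \<delta>: "\<delta> > 0" "\<And>q. norm q < \<delta> \<Longrightarrow> norm (j7star_root q - 1) \<le> C * norm q"
    using j7star_root_near_0 by blast
  \<comment> \<open>Im \<tau> >= M gives |q| <= \<delta>/e; the 1 in the numerator secures the
    strict inequality.\<close>
  define M where "M = (1 - ln \<delta>) / (2 * pi)"
  show "\<exists>C M. \<forall>\<tau>\<in>upper_half_plane. Im \<tau> \<ge> M \<longrightarrow>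
       norm (j7star_root (qn \<tau>) / qpow (1/3) \<tau> * qpow (1/3) \<tau> - 1) \<le> C * norm (qn \<tau>)"
  proof (intro exI ballI impI)
    fix \<tau> assume "Im \<tau> \<ge> M"
    then have "- 2 * pi * Im \<tau> < ln \<delta>" by (simp add: M_def field_simps)
    then have "norm (qn \<tau>) < \<delta>"
      unfolding norm_qn using \<delta>(1) by (metis exp_less_cancel_iff exp_ln)
    then show "norm (j7star_root (qn \<tau>) / qpow (1/3) \<tau> * qpow (1/3) \<tau> - 1) \<le> C * norm (qn \<tau>)"
      using \<delta>(2) by (simp add: qpow_def)
  qed
qed

end
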